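(* The twisted cut-and-join operator $\mathcal{CJ}^{\sim}$ is given by $$\mathcal{CJ}^{\sim}=\sum_{i,j\ge1}\Bigl((i+j)p_ip_j\frac{\partial}{\partial p_{i+j}}+2ij\,p_{i+j}\frac{\partial^2}{\partial p_i\partial p_j}\Bigr)+\sum_{k\ge1}k(k-1)p_k\frac{\partial}{\partial p_k}$$ $$=\sum_{i,j\ge1}\Bigl((i+j)(p_ip_j+p_{i+j})\frac{\partial}{\partial p_{i+j}}+2ij\,p_{i+j}\frac{\partial^2}{\partial p_i\partial p_j}\Bigr).$$
   Context: Let $\tau=(1,n+1)(2,n+2)\cdots(n,2n)\in S_{2n}$ and let $B_n=C(\tau)$ be its centralizer in $S_{2n}$. For a partition $\lambda=(\lambda_1,\dots,\lambda_s)$ of $n$, $B_\lambda^{\sim}$ is the set of $\sigma\in S_{2n}$ with $\tau\sigma\tau=\sigma^{-1}$ whose decomposition into independent cycles (fixed points included) consists of $s$ pairs of $\tau$-symmetric cycles of lengths $\lambda_1,\dots,\lambda_s$ (distinct cycles $(u_1\dots u_k)$ and $(\tau(u_k)\dots\tau(u_1))$ are called $\tau$-symmetric); $B_n^{\sim}=\bigsqcup_{|\lambda|=n}B_\lambda^{\sim}$. $\mathbb C[B_n^{\sim}]$ is the vector space with basis $B_n^{\sim}$, and $\mathcal Z(B_n^{\sim})=\{y\in\mathbb C[B_n^{\sim}]\mid xyx^{-1}=y\ \forall x\in B_n\}$; it has as a basis the conjugacy class sums $\mathcal C_\lambda^{\sim}=\sum_{\sigma\in B_\lambda^{\sim}}\sigma$,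 $|\lambda|=n$. Let $\mathbb C[p]$ be the space of polynomials in $p_1,p_2,\dots$ with $\deg p_k=k$, and $\mathbb C[p]_n$ the homogeneous polynomials of degree $n$. $\Psi:\mathcal Z(B_n^{\sim})\to\mathbb C[p]_n$ is the linear isomorphism with $\Psi(\mathcal C_\lambda^{\sim})=p_\lambda=p_{\lambda_1}\cdots p_{\lambda_s}$. The operator $\mathfrak{CJ}^{\sim}:\mathcal Z(B_n^{\sim})\to\mathcal Z(B_n^{\sim})$ is defined by $$\mathfrak{CJ}^{\sim}(\sigma)=\sum_{1\le i<j\le 2n,\ j\ne\tau(i)}(i\,j)\,\sigma\,(\tau(i)\,\tau(j)),\qquad \sigma\in B_n^{\sim}$$ (extended linearly). The twisted cut-and-join operator $\mathcal{CJ}^{\sim}:\mathbb C[p]_n\to\mathbb C[p]_n$ (for every $n$) is the linear map with $\mathcal{CJ}^{\sim}\circ\Psi=\Psi\circ\mathfrak{CJ}^{\sim}$.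
   Formalization: The isomorphism Ψ is normalized by sending the class sum C_λ to |B_λ|·p_λ (each σ in B_λ to p_λ) instead of to p_λ; with the stated normalization the formula fails for n = 2, where p_1² would map to 2p_2 instead of 4p_2. *)

theory Defs
  imports Complex_Main "HOL-Library.Poly_Mapping" "HOL-Library.Multiset" "HOL-Combinatorics.Cycles"
begin

section \<open>Linear combinations\<close>

text \<open>
  A finitely supported function \<^typ>\<open>'a \<Rightarrow>\<^sub>0 complex\<close> is a formal complex linear combination of
  elements of \<^typ>\<open>'a\<close>; \<^term>\<open>Poly_Mapping.single a 1\<close> is the basis vector of \<^term>\<open>a\<close>.
\<close>

definition scale :: "complex \<Rightarrow> ('a \<Rightarrow>\<^sub>0 complex) \<Rightarrow> ('a \<Rightarrow>\<^sub>0 complex)"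
  where "scale c v = Poly_Mapping.map (\<lambda>a. c * a) v"

definition linear_extend :: "('a \<Rightarrow> ('b \<Rightarrow>\<^sub>0 complex)) \<Rightarrow> ('a \<Rightarrow>\<^sub>0 complex) \<Rightarrow> ('b \<Rightarrow>\<^sub>0 complex)"
  where "linear_extend f v = (\<Sum>a\<in>Poly_Mapping.keys v. scale (Poly_Mapping.lookup v a) (f a))"


section \<open>The involution, its centralizer, and the twisted classes\<close>

definition tau :: "nat \<Rightarrow> nat \<Rightarrow> nat"
  where "tau n i = (if 1 \<le> i \<and> i \<le> n then i + n else if n < i \<and> i \<le> 2 * n then i - n else i)"

definition centralizer_tau :: "nat \<Rightarrow> (nat \<Rightarrow> nat) set"
  where "centralizer_tau n = {x. x permutes {1..2*n} \<and> x \<circ> tau n = tau n \<circ> x}"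

definition partitions :: "nat \<Rightarrow> nat multiset set"
  where "partitions n = {\<mu>. 0 \<notin># \<mu> \<and> sum_mset \<mu> = n}"

definition tau_sym :: "nat \<Rightarrow> nat list \<Rightarrow> nat list"
  where "tau_sym n us = map (tau n) (rev us)"

definition cycle_product :: "nat list list \<Rightarrow> nat \<Rightarrow> nat"
  where "cycle_product css = foldr (\<lambda>cs f. cycle_of_list cs \<circ> f) css id"

text \<open>
  The lists in \<open>css\<close> and their \<open>\<tau>\<close>-symmetric images are pairwise disjoint and exhaust
  \<open>{1..2n}\<close>, so they are all the independent cycles of \<open>\<sigma>\<close>, with fixed points as lists of length 1;
  in particular the two cycles of each pair are distinct.
\<close>

definition twisted_class :: "nat \<Rightarrow> nat multiset \<Rightarrow> (nat \<Rightarrow> nat) set"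
  where "twisted_class n \<mu> =
    {\<sigma>. \<sigma> permutes {1..2*n} \<and> tau n \<circ> \<sigma> \<circ> tau n = inv \<sigma> \<and>
        (\<exists>css. mset (map length css) = \<mu> \<and>
               distinct (concat (css @ map (tau_sym n) css)) \<and>
               set (concat (css @ map (tau_sym n) css)) = {1..2*n} \<and>
               \<sigma> = cycle_product (css @ map (tau_sym n) css))}"

definition twisted :: "nat \<Rightarrow> (nat \<Rightarrow> nat) set"
  where "twisted n = (\<Union>\<mu>\<in>partitions n. twisted_class n \<mu>)"

definition conjugate :: "(nat \<Rightarrow> nat) \<Rightarrow> ((nat \<Rightarrow> nat) \<Rightarrow>\<^sub>0 complex) \<Rightarrow> ((nat \<Rightarrow> nat) \<Rightarrow>\<^sub>0 complex)"
  where "conjugate x = linear_extend (\<lambda>\<sigma>. Poly_Mapping.single (x \<circ> \<sigma> \<circ> inv x) 1)"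

definition twisted_center :: "nat \<Rightarrow> ((nat \<Rightarrow> nat) \<Rightarrow>\<^sub>0 complex) set"
  where "twisted_center n =
    {y. Poly_Mapping.keys y \<subseteq> twisted n \<and> (\<forall>x\<in>centralizer_tau n. conjugate x y = y)}"

definition class_sum :: "nat \<Rightarrow> nat multiset \<Rightarrow> ((nat \<Rightarrow> nat) \<Rightarrow>\<^sub>0 complex)"
  where "class_sum n \<mu> = (\<Sum>\<sigma>\<in>twisted_class n \<mu>. Poly_Mapping.single \<sigma> 1)"

definition twisted_CJ_perm :: "nat \<Rightarrow> ((nat \<Rightarrow> nat) \<Rightarrow>\<^sub>0 complex) \<Rightarrow> ((nat \<Rightarrow> nat) \<Rightarrow>\<^sub>0 complex)"
  where "twisted_CJ_perm n = linear_extend (\<lambda>\<sigma>.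
    \<Sum>(i, j)\<in>{(i, j). 1 \<le> i \<and> i < j \<and> j \<le> 2 * n \<and> j \<noteq> tau n i}.
      Poly_Mapping.single (transpose i j \<circ> \<sigma> \<circ> transpose (tau n i) (tau n j)) 1)"


section \<open>Polynomials in \<open>p\<^sub>1, p\<^sub>2, \<dots>\<close>\<close>

text \<open>
  A monomial is its exponent vector \<^typ>\<open>nat \<Rightarrow>\<^sub>0 nat\<close>, and the product of \<^typ>\<open>(nat \<Rightarrow>\<^sub>0 nat) \<Rightarrow>\<^sub>0 complex\<close>
  is the convolution product, i.e. multiplication of polynomials. Only the variables
  with positive index belong to \<open>\<complex>[p]\<close>; the exponent of the unused variable of index 0 is
  required to vanish in \<open>hom_polys\<close>.
\<close>

type_synonym poly_p = "(nat \<Rightarrow>\<^sub>0 nat) \<Rightarrow>\<^sub>0 complex"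

definition pvar :: "nat \<Rightarrow> poly_p"
  where "pvar k = Poly_Mapping.single (Poly_Mapping.single k 1) 1"

definition pderiv_var :: "nat \<Rightarrow> poly_p \<Rightarrow> poly_p"
  where "pderiv_var k = linear_extend (\<lambda>m.
    Poly_Mapping.single (m - Poly_Mapping.single k 1) (of_nat (Poly_Mapping.lookup m k)))"

definition weight :: "(nat \<Rightarrow>\<^sub>0 nat) \<Rightarrow> nat"
  where "weight m = (\<Sum>k\<in>Poly_Mapping.keys m. k * Poly_Mapping.lookup m k)"

definition hom_polys :: "nat \<Rightarrow> poly_p set"
  where "hom_polys n =
    {f. \<forall>m\<in>Poly_Mapping.keys f. Poly_Mapping.lookup m 0 = 0 \<and> weight m = n}"

definition p_part :: "nat multiset \<Rightarrow> poly_p"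
  where "p_part \<mu> = prod_mset (image_mset pvar \<mu>)"


section \<open>The isomorphism \<open>\<Psi>\<close> and the twisted cut-and-join operator\<close>

text \<open>
  \<open>\<Psi>\<close> sends every \<open>\<sigma>\<close> of type \<open>\<mu>\<close> to \<open>p\<^sub>\<mu>\<close>. Thus it takes the average of the class of \<open>\<mu>\<close>, and not the
  plain class sum, to \<open>p\<^sub>\<mu>\<close>; this normalization is forced by the differential formula
  for the twisted cut-and-join operator.
  Indeed, let \<open>n = 2\<close>. The class of type (1,1) is {id}, that of type (2) is {(12)(34), (14)(23)}, and
  the operator on permutations takes id to 2((12)(34) + (14)(23)). With plain class sums sent to
  \<open>p\<^sub>\<mu>\<close> the induced operator would map \<open>p\<^sub>1\<^sup>2\<close> to \<open>2 p\<^sub>2\<close>, whereas the differential operator maps it to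
  \<open>4 p\<^sub>2\<close>, which is the image obtained with the normalization used here.
\<close>

definition Psi :: "nat \<Rightarrow> ((nat \<Rightarrow> nat) \<Rightarrow>\<^sub>0 complex) \<Rightarrow> poly_p"
  where "Psi n y =
    (\<Sum>\<mu>\<in>partitions n. scale (\<Sum>\<sigma>\<in>twisted_class n \<mu>. Poly_Mapping.lookup y \<sigma>) (p_part \<mu>))"

definition twisted_CJ :: "nat \<Rightarrow> poly_p \<Rightarrow> poly_p"
  where "twisted_CJ n f = Psi n (twisted_CJ_perm n (inv_into (twisted_center n) (Psi n) f))"


section \<open>Properties\<close>

text \<open>
  The main facts are: \<open>\<Psi>\<close> is a linear bijection from \<open>twisted_center n\<close> onto \<open>hom_polys n\<close> with
  \<open>\<Psi>(C\<^sub>\<mu>) = |B\<^sub>\<mu>| p\<^sub>\<mu>\<close> (\<open>Psi_add\<close>, \<open>Psi_scale\<close>, \<open>Psi_bij_betw\<close>, \<open>Psi_class_sum\<close>), and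
  \<open>twisted_CJ\<close> is intertwined with \<open>twisted_CJ_perm\<close> by \<open>\<Psi>\<close> (\<open>twisted_CJ_Psi\<close>).
\<close>

lemma lookup_scale [simp]: "Poly_Mapping.lookup (scale c v) a = c * Poly_Mapping.lookup v a"
  by (simp add: scale_def Poly_Mapping.map.rep_eq when_def)

lemma scale_zero [simp]: "scale 0 v = 0" "scale c 0 = 0"
  by (rule poly_mapping_eqI; simp)+

lemma lookup_linear_extend:
  "Poly_Mapping.lookup (linear_extend f v) b =
    (\<Sum>a\<in>Poly_Mapping.keys v. Poly_Mapping.lookup v a * Poly_Mapping.lookup (f a) b)"
  by (simp add: linear_extend_def lookup_sum)

lemma finite_partitions: "finite (partitions n)"
proof -
  have "partitions n \<subseteq> (\<Union>k\<le>n. {X. set_mset X \<subseteq> {..n} \<and> size X = k})"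
  proof
    fix \<mu> assume \<mu>: "\<mu> \<in> partitions n"
    have "size \<mu> \<le> sum_mset \<mu>" if "0 \<notin># \<mu>"
      using that by (induction \<mu>) auto
    moreover have "x \<le> sum_mset \<mu>" if "x \<in># \<mu>" for x
      using that by (metis le_add1 multi_member_split sum_mset.add_mset)
    ultimately show "\<mu> \<in> (\<Union>k\<le>n. {X. set_mset X \<subseteq> {..n} \<and> size X = k})"
      using \<mu> by (auto simp: partitions_def)
  qed
  moreover have "finite (\<Union>k\<le>n. {X. set_mset X \<subseteq> {..n} \<and> size X = k})"
    using finite_multisets_of_size[of "{..n}"] by (auto simp: multisets_of_size_def)
  ultimately show ?thesis by (rule finite_subset)
qed

lemma finite_twisted_class: "finite (twisted_class n \<mu>)"
  by (rule finite_subset[OF _ finite_permutations[of "{1..2*n}"]]) (auto simp: twisted_class_def)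

lemma tau_tau [simp]: "tau n (tau n i) = i"
  by (auto simp: tau_def)

lemma tau_comp_tau: "tau n \<circ> tau n = id"
  by (auto simp: fun_eq_iff)

lemma bij_tau: "bij (tau n)"
  using tau_comp_tau o_bij by blast

lemma inj_tau: "inj_on (tau n) A"
  using bij_tau by (meson bij_is_inj inj_on_subset subset_UNIV)

lemma inv_tau: "inv (tau n) = tau n"
  by (rule inv_unique_comp) (simp_all add: tau_comp_tau)

lemma tau_image: "tau n ` {1..2*n} = {1..2*n}"
proof -
  have "tau n ` {1..2*n} \<subseteq> {1..2*n}" by (auto simp: tau_def)
  then show ?thesis by (metis card_image card_subset_eq finite_atLeastAtMost inj_tau)
qed

lemma cycle_product_outside:
  "x \<notin> set (concat css) \<Longrightarrow> cycle_product css x = x"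
proof (induction css)
  case (Cons c css)
  then show ?case by (simp add: cycle_product_def id_outside_supp)
qed (simp add: cycle_product_def)

lemma cycle_of_list_in: "x \<in> set c \<Longrightarrow> cycle_of_list c x \<in> set c"
  using cycle_permutes[of c] by (simp add: permutes_in_image)

lemma cycle_product_inside:
  assumes "distinct (concat css)" "c \<in> set css" "x \<in> set c"
  shows "cycle_product css x = cycle_of_list c x"
  using assms
proof (induction css)
  case (Cons d css)
  have step: "cycle_product (d # css) x = cycle_of_list d (cycle_product css x)"
    by (simp add: cycle_product_def)
  show ?case
  proof (cases "x \<in> set d")
    case True
    then have "x \<notin> set (concat css)" using Cons.prems by auto
    moreover have "c = d" using Cons.prems True by auto
    ultimately show ?thesis using step cycle_product_outside by metis
  next
    case False
    then have c: "c \<in> set css" using Cons.prems by auto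
    then have "cycle_product css x = cycle_of_list c x" using Cons by auto
    moreover have "cycle_of_list c x \<notin> set d"
      using cycle_of_list_in[OF Cons.prems(3)] Cons.prems(1) c by auto
    ultimately show ?thesis using step id_outside_supp by metis
  qed
qed simp

lemma cycle_product_permutes: "(cycle_product css) permutes (set (concat css))"
proof (induction css)
  case (Cons c css)
  have "cycle_of_list c permutes set (concat (c # css))"
    by (rule permutes_subset[OF cycle_permutes]) simp
  moreover have "cycle_product css permutes set (concat (c # css))"
    by (rule permutes_subset[OF Cons]) simp
  ultimately have "cycle_of_list c \<circ> cycle_product css permutes set (concat (c # css))"
    by (rule permutes_compose[rotated])
  moreover have "cycle_product (c # css) = cycle_of_list c \<circ> cycle_product css"
    by (simp add: cycle_product_def)
  ultimately show ?case by (simp only:)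
qed (simp add: cycle_product_def permutes_def)

lemma cycle_product_cong_set:
  assumes "distinct (concat css)" "distinct (concat dss)" "set css = set dss"
  shows "cycle_product css = cycle_product dss"
proof
  fix x
  show "cycle_product css x = cycle_product dss x"
  proof (cases "x \<in> set (concat css)")
    case True
    then obtain c where "c \<in> set css" "x \<in> set c" by auto
    then show ?thesis using assms cycle_product_inside by metis
  next
    case False
    then have "x \<notin> set (concat dss)" using assms by simp
    then show ?thesis using False cycle_product_outside by metis
  qed
qed

lemma cycle_product_conj:
  assumes "distinct (concat css)" "bij p"
  shows "p \<circ> cycle_product css \<circ> inv p = cycle_product (map (map p) css)"
  using assms(1)
proof (induction css)
  case Nil
  then show ?case using assms(2) by (simp add: cycle_product_def fun_eq_iff bij_is_surj surj_f_inv_f)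
next
  case (Cons c css)
  have "p \<circ> cycle_product (c # css) \<circ> inv p
      = (p \<circ> cycle_of_list c \<circ> inv p) \<circ> (p \<circ> cycle_product css \<circ> inv p)"
    using assms(2) by (simp add: cycle_product_def fun_eq_iff bij_is_inj)
  also have "p \<circ> cycle_of_list c \<circ> inv p = cycle_of_list (map p c)"
    using conjugation_of_cycle[of c p] Cons.prems assms(2) by auto
  also have "p \<circ> cycle_product css \<circ> inv p = cycle_product (map (map p) css)"
    by (rule Cons.IH) (use Cons.prems in simp)
  finally show ?case by (simp add: cycle_product_def)
qed

lemma cycle_of_list_rev:
  assumes "distinct c"
  shows "cycle_of_list (rev c) (cycle_of_list c x) = x"
proof (cases "x \<in> set c")
  case False
  then show ?thesis by (simp add: id_outside_supp)
next
  case True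
  then obtain a as where c: "c = a # as" by (cases c) auto
  define d where "d = a # rev as"
  have d: "distinct d" using assms c by (simp add: d_def)
  have "cycle_of_list (rev c) = cycle_of_list d"
    using cycle_of_list_rotate_independent[OF d, of 1] by (simp add: c d_def)
  moreover have "map (cycle_of_list d) d = rotate1 d"
    using cyclic_rotation[OF d, of 1] by simp
  then have "rev (map (cycle_of_list d) d) = rev (rotate1 d)" by simp
  then have "map (cycle_of_list d) (rotate1 c) = c"
    by (simp add: d_def c rev_map)
  moreover have "map (cycle_of_list c) c = rotate1 c"
    using cyclic_rotation[OF assms, of 1] by simp
  ultimately have "map (\<lambda>x. cycle_of_list (rev c) (cycle_of_list c x)) c = map (\<lambda>x. x) c"
    by (metis (no_types, lifting) list.map_comp list.map_ident map_eq_conv o_apply)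
  then show ?thesis using True by (simp only: map_eq_conv)
qed

lemma cycle_product_funpow:
  assumes "distinct (concat css)" "c \<in> set css" "x \<in> set c"
  shows "(cycle_product css ^^ m) x = x \<longleftrightarrow> length c dvd m"
proof -
  have dc: "distinct c" using assms by (auto simp: distinct_concat_iff)
  have *: "(cycle_product css ^^ m) x = (cycle_of_list c ^^ m) x \<and> (cycle_of_list c ^^ m) x \<in> set c" for m
  proof (induction m)
    case (Suc m)
    then show ?case using cycle_product_inside[OF assms(1,2)] cycle_of_list_in by auto
  qed (use assms in auto)
  obtain i where i: "i < length c" "x = c ! i" using assms(3) by (auto simp: in_set_conv_nth)
  have "(cycle_of_list c ^^ m) x = rotate m c ! i"
    using cyclic_rotation[OF dc, of m] i by (metis nth_map)
  also have "\<dots> = c ! ((m + i) mod length c)" using i by (simp add: nth_rotate)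
  finally have "(cycle_product css ^^ m) x = x \<longleftrightarrow> c ! ((m + i) mod length c) = c ! i" using * i by metis
  also have "\<dots> \<longleftrightarrow> (m + i) mod length c = i mod length c"
    using i dc by (subst nth_eq_iff_index_eq) (auto intro: mod_less_divisor)
  also have "\<dots> \<longleftrightarrow> length c dvd m"
    by (metis add.commute add_diff_cancel_left' le_add1 mod_eq_dvd_iff_nat)
  finally show ?thesis .
qed

definition period_set :: "(nat \<Rightarrow> nat) \<Rightarrow> nat set \<Rightarrow> nat \<Rightarrow> nat set"
  where "period_set \<sigma> A k = {x \<in> A. \<forall>m. (\<sigma> ^^ m) x = x \<longleftrightarrow> k dvd m}"

lemma card_period_set:
  assumes "distinct (concat css)"
  shows "card (period_set (cycle_product css) (set (concat css)) k) = k * count (mset (map length css)) k"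
proof -
  define ds where "ds = filter (\<lambda>c. length c = k) css"
  have "period_set (cycle_product css) (set (concat css)) k = set (concat ds)"
  proof (intro set_eqI iffI)
    fix x assume x: "x \<in> period_set (cycle_product css) (set (concat css)) k"
    then obtain c where c: "c \<in> set css" "x \<in> set c" by (auto simp: period_set_def)
    have "length c dvd m \<longleftrightarrow> k dvd m" for m
      using x cycle_product_funpow[OF assms c] by (auto simp: period_set_def)
    then have "length c = k" by (meson dvd_antisym dvd_refl)
    then show "x \<in> set (concat ds)" using c by (auto simp: ds_def)
  next
    fix x assume "x \<in> set (concat ds)"
    then obtain c where c: "c \<in> set css" "x \<in> set c" "length c = k" by (auto simp: ds_def)
    then show "x \<in> period_set (cycle_product css) (set (concat css)) k"
      using cycle_product_funpow[OF assms c(1,2)] by (auto simp: period_set_def)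
  qed
  moreover have "distinct (concat ds)"
    using assms unfolding ds_def
    by (induction css) auto
  moreover have "length (concat ds) = k * count (mset (map length css)) k"
    unfolding ds_def by (induction css) auto
  ultimately show ?thesis by (metis distinct_card)
qed

lemma map_length_tau_sym: "map length (css @ map (tau_sym n) css) = map length css @ map length css"
  by (simp add: tau_sym_def)

lemma twisted_class_disjoint:
  assumes "\<sigma> \<in> twisted_class n \<mu>" "\<sigma> \<in> twisted_class n \<nu>" "0 \<notin># \<mu>" "0 \<notin># \<nu>"
  shows "\<mu> = \<nu>"
proof -
  have *: "card (period_set \<sigma> {1..2*n} k) = k * (2 * count \<mu> k)" if mem: "\<sigma> \<in> twisted_class n \<mu>" for k \<mu>
  proof -
    obtain css where css: "mset (map length css) = \<mu>"
      "distinct (concat (css @ map (tau_sym n) css))"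
      "set (concat (css @ map (tau_sym n) css)) = {1..2*n}"
      "\<sigma> = cycle_product (css @ map (tau_sym n) css)"
      using mem unfolding twisted_class_def by blast
    show ?thesis
      using card_period_set[OF css(2), of k] unfolding map_length_tau_sym css(3) css(4)[symmetric] mset_append css(1)
      by (simp add: mult_2)
  qed
  show ?thesis
  proof (rule multiset_eqI)
    fix k
    show "count \<mu> k = count \<nu> k"
    proof (cases "k = 0")
      case True
      then show ?thesis using assms(3,4) by (simp add: not_in_iff)
    next
      case False
      then show ?thesis using *[OF assms(1), of k] *[OF assms(2), of k] by simp
    qed
  qed
qed

lemma chunks: "sum_list ls = length xs \<Longrightarrow> \<exists>css. concat css = xs \<and> map length css = ls"
proof (induction ls arbitrary: xs)
  case Nil
  then show ?case by (intro exI[of _ "[]"]) simp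
next
  case (Cons l ls)
  then have "sum_list ls = length (drop l xs)" by simp
  then obtain css where "concat css = drop l xs" "map length css = ls" using Cons.IH by blast
  then show ?case using Cons.prems by (intro exI[of _ "take l xs # css"]) (auto simp: min_def)
qed

lemma concat_map_tau_sym: "mset (concat (map (tau_sym n) css)) = image_mset (tau n) (mset (concat css))"
  by (induction css) (auto simp: tau_sym_def)

lemma twisted_class_nonempty:
  assumes "\<mu> \<in> partitions n"
  shows "twisted_class n \<mu> \<noteq> {}"
proof -
  obtain ls where ls: "mset ls = \<mu>" using ex_mset by blast
  have "sum_list ls = length [1..<Suc n]"
    using assms ls by (auto simp: partitions_def sum_mset_sum_list[symmetric])
  then obtain css where css: "concat css = [1..<Suc n]" "map length css = ls" using chunks by blast
  let ?L = "css @ map (tau_sym n) css"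
  have m: "mset (concat ?L) = mset ([1..<Suc n] @ map (tau n) [1..<Suc n])"
    using concat_map_tau_sym[of n css] by (simp only: concat_append mset_append css(1) mset_map)
  have ti: "tau n ` {1..<Suc n} = {n+1..2*n}"
  proof
    show "{n+1..2*n} \<subseteq> tau n ` {1..<Suc n}"
    proof
      fix x assume "x \<in> {n+1..2*n}"
      then have "x = tau n (x - n)" "x - n \<in> {1..<Suc n}" by (auto simp: tau_def)
      then show "x \<in> tau n ` {1..<Suc n}" by blast
    qed
  qed (auto simp: tau_def)
  have "distinct ([1..<Suc n] @ map (tau n) [1..<Suc n])"
    using ti inj_tau[of n] by (simp only: distinct_append distinct_map set_map set_upt) auto
  then have d: "distinct (concat ?L)" using m mset_eq_imp_distinct_iff by blast
  have "set (concat ?L) = set ([1..<Suc n] @ map (tau n) [1..<Suc n])"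
    using m mset_eq_setD by blast
  also have "\<dots> = {1..<Suc n} \<union> {n+1..2*n}" using ti by (simp only: set_append set_map set_upt)
  also have "\<dots> = {1..2*n}" by auto
  finally have s: "set (concat ?L) = {1..2*n}" .
  define \<sigma> where "\<sigma> = cycle_product ?L"
  have p: "\<sigma> permutes {1..2*n}" using cycle_product_permutes[of ?L] s by (simp only: \<sigma>_def)
  have conj: "tau n \<circ> \<sigma> \<circ> tau n = cycle_product (map (map (tau n)) ?L)"
    using cycle_product_conj[OF d bij_tau] by (simp only: \<sigma>_def inv_tau)
  have tt: "map (tau n) (map (tau n) c) = c" for c by (simp add: comp_def)
  have d': "distinct (concat (map (map (tau n)) ?L))"
    using d by (simp only: map_concat[symmetric] distinct_map inj_tau simp_thms)
  have rv: "rev c \<in> set (map (map (tau n)) ?L)" if "c \<in> set ?L" for c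
  proof -
    consider "c \<in> set css" | b where "b \<in> set css" "c = tau_sym n b" using \<open>c \<in> set ?L\<close> by auto
    then show ?thesis
    proof cases
      case 1
      then have "tau_sym n c \<in> set ?L" by simp
      moreover have "rev c = map (tau n) (tau_sym n c)" by (simp add: tau_sym_def comp_def)
      ultimately show ?thesis by (metis imageI list.set_map)
    next
      case 2
      then have "rev c = map (tau n) b" by (simp add: tau_sym_def rev_map)
      then show ?thesis using 2 by auto
    qed
  qed
  have "(tau n \<circ> \<sigma> \<circ> tau n) (\<sigma> x) = x" for x
  proof (cases "x \<in> set (concat ?L)")
    case True
    then obtain c where c: "c \<in> set ?L" "x \<in> set c" by auto
    have "\<sigma> x = cycle_of_list c x" using cycle_product_inside[OF d c] by (simp only: \<sigma>_def)
    moreover have "\<sigma> x \<in> set (rev c)" using calculation cycle_of_list_in c by simp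
    then have "cycle_product (map (map (tau n)) ?L) (\<sigma> x) = cycle_of_list (rev c) (\<sigma> x)"
      using cycle_product_inside[OF d' rv[OF c(1)]] by blast
    moreover have "distinct c" using d c(1) by (meson distinct_concat_iff)
    ultimately show ?thesis using conj cycle_of_list_rev by metis
  next
    case False
    then have "\<sigma> x = x" using cycle_product_outside by (simp only: \<sigma>_def)
    moreover have "tau n x \<notin> {1..2*n}" using False s tau_image by (metis imageI tau_tau)
    then have "\<sigma> (tau n x) = tau n x" using p by (simp add: permutes_def)
    ultimately show ?thesis by simp
  qed
  then have "(tau n \<circ> \<sigma> \<circ> tau n) \<circ> \<sigma> = id" by (auto simp: fun_eq_iff)
  then have "tau n \<circ> \<sigma> \<circ> tau n = inv \<sigma>"
    by (metis (no_types, lifting) comp_assoc comp_id id_comp p permutes_inv_o(1))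
  then have "\<sigma> \<in> twisted_class n \<mu>"
    unfolding twisted_class_def using p css(2) ls d s \<sigma>_def by blast
  then show ?thesis by blast
qed

lemma reorder:
  assumes "mset (map f xs) = mset ys"
  shows "\<exists>zs. mset zs = mset xs \<and> map f zs = ys"
  using assms
proof (induction ys arbitrary: xs)
  case (Cons y ys)
  then have "y \<in> set (map f xs)" by (metis list.set_intros(1) set_mset_mset)
  then obtain x where x: "x \<in> set xs" "f x = y" by auto
  have "mset (map f xs) = add_mset (f x) (mset (map f (remove1 x xs)))"
    using x(1) by (induction xs) auto
  then have "add_mset y (mset (map f (remove1 x xs))) = add_mset y (mset ys)"
    using Cons.prems x(2) by simp
  then have "mset (map f (remove1 x xs)) = mset ys" by simp
  then obtain zs where "mset zs = mset (remove1 x xs)" "map f zs = ys" using Cons.IH by blast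
  then show ?case using x by (intro exI[of _ "x # zs"]) simp
qed auto

lemma concat_eq_imp: "concat xss = concat yss \<Longrightarrow> map length xss = map length yss \<Longrightarrow> xss = yss"
proof (induction xss arbitrary: yss)
  case (Cons x xss)
  then show ?case by (cases yss) auto
qed auto

lemma twisted_class_conj:
  assumes "\<sigma> \<in> twisted_class n \<mu>" "\<sigma>' \<in> twisted_class n \<mu>"
  shows "\<exists>x\<in>centralizer_tau n. x \<circ> \<sigma> \<circ> inv x = \<sigma>'"
proof -
  obtain css where css: "mset (map length css) = \<mu>"
      "distinct (concat (css @ map (tau_sym n) css))"
      "set (concat (css @ map (tau_sym n) css)) = {1..2*n}"
      "\<sigma> = cycle_product (css @ map (tau_sym n) css)"
    using assms(1) unfolding twisted_class_def by blast
  obtain css' where css': "mset (map length css') = \<mu>"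
      "distinct (concat (css' @ map (tau_sym n) css'))"
      "set (concat (css' @ map (tau_sym n) css')) = {1..2*n}"
      "\<sigma>' = cycle_product (css' @ map (tau_sym n) css')"
    using assms(2) unfolding twisted_class_def by blast
  obtain ds where ds: "mset ds = mset css'" "map length ds = map length css"
    using reorder[of length css' "map length css"] css(1) css'(1) by auto
  let ?L = "css @ map (tau_sym n) css" and ?D = "ds @ map (tau_sym n) ds" and ?L' = "css' @ map (tau_sym n) css'"
  have mD: "mset (map mset ?D) = mset (map mset ?L')" by (simp only: map_append mset_append mset_map) (simp only: ds(1))
  have mset_concat: "mset (concat xs) = \<Sum>\<^sub># (mset (map mset xs))" for xs :: "nat list list"
    by (induction xs) auto
  have mD: "mset (concat ?D) = mset (concat ?L')" by (simp only: mset_concat mD)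
  have dD: "distinct (concat ?D)" using mD css'(2) mset_eq_imp_distinct_iff by blast
  have sD: "set (concat ?D) = {1..2*n}" using mD css'(3) mset_eq_setD by metis
  have "set ds = set css'" using ds(1) mset_eq_setD by blast
  then have "set ?D = set ?L'" by simp
  then have \<sigma>': "\<sigma>' = cycle_product ?D" using css'(2,4) dD cycle_product_cong_set by blast
  have lenLD: "map length ?L = map length ?D" by (simp only: map_length_tau_sym ds(2))
  then have len: "length (concat ?L) = length (concat ?D)" by (simp only: length_concat)
  define x where "x = (\<lambda>u. case map_of (zip (concat ?L) (concat ?D)) u of Some v \<Rightarrow> v | None \<Rightarrow> u)"
  have xnth: "x (concat ?L ! i) = concat ?D ! i" if "i < length (concat ?L)" for i
    using that map_of_zip_nth[OF len css(2)] len by (simp add: x_def)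
  have xm: "map x (concat ?L) = concat ?D"
    by (rule nth_equalityI) (simp_all only: length_map len nth_map xnth)
  have xo: "x u = u" if "u \<notin> {1..2*n}" for u
  proof -
    have "u \<notin> set (concat ?L)" using that css(3) by blast
    then have "map_of (zip (concat ?L) (concat ?D)) u = None"
      using map_of_zip_is_None[OF len] by blast
    then show ?thesis by (simp only: x_def option.case)
  qed
  have "x ` {1..2*n} = {1..2*n}" using xm sD css(3) by (metis list.set_map)
  then have "bij_betw x {1..2*n} {1..2*n}"
    by (simp add: bij_betw_def eq_card_imp_inj_on)
  then have xp: "x permutes {1..2*n}" using xo by (intro bij_imp_permutes) auto
  then have bx: "bij x" by (rule permutes_bij)
  have mapL: "map (map x) ?L = ?D"
    by (rule concat_eq_imp) (use xm lenLD in \<open>simp_all add: map_concat comp_def\<close>)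
  have "length css = length ds" using ds(2) map_eq_imp_length_eq by metis
  then have mc: "map (map x) css = ds" and mt: "map (map x) (map (tau_sym n) css) = map (tau_sym n) ds"
    using mapL by auto
  have c1: "x (tau n u) = tau n (x u)" if "c \<in> set css" "u \<in> set c" for c u
  proof -
    have "map (map x) (map (tau_sym n) css) = map (tau_sym n) (map (map x) css)" using mc mt by simp
    then have "map x (tau_sym n c) = tau_sym n (map x c)" using that(1) by (simp add: comp_def)
    then have "rev (map x (tau_sym n c)) = rev (tau_sym n (map x c))" by simp
    then have "map (\<lambda>u. x (tau n u)) c = map (\<lambda>u. tau n (x u)) c"
      by (simp add: tau_sym_def rev_map comp_def)
    then show ?thesis using that(2) by simp
  qed
  have "x (tau n u) = tau n (x u)" for u
  proof (cases "u \<in> {1..2*n}")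
    case True
    then have "u \<in> set (concat ?L)" using css(3) by blast
    then obtain c where c: "c \<in> set ?L" "u \<in> set c" unfolding set_concat by blast
    show ?thesis
    proof (cases "c \<in> set css")
      case True then show ?thesis using c c1 by blast
    next
      case False
      then obtain b where b: "b \<in> set css" "c = tau_sym n b" using c by auto
      then obtain v where v: "v \<in> set b" "u = tau n v" using c(2) by (auto simp: tau_sym_def)
      have "x u = tau n (x v)" using c1[OF b(1) v(1)] v(2) by simp
      then show ?thesis by (simp add: v(2))
    qed
  next
    case False
    then have "tau n u \<notin> {1..2*n}" using tau_image by (metis imageI tau_tau)
    then show ?thesis using False xo by simp
  qed
  then have "x \<circ> tau n = tau n \<circ> x" by (intro ext) (simp only: o_apply)
  then have "x \<in> centralizer_tau n" using xp unfolding centralizer_tau_def by blast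
  moreover have "x \<circ> \<sigma> \<circ> inv x = cycle_product (map (map x) ?L)"
    unfolding css(4) by (rule cycle_product_conj[OF css(2) bx])
  then have "x \<circ> \<sigma> \<circ> inv x = \<sigma>'" unfolding mapL \<sigma>' .
  ultimately show ?thesis by blast
qed

lemma conjugate_twisted_class:
  assumes "\<sigma> \<in> twisted_class n \<mu>" "x \<in> centralizer_tau n"
  shows "x \<circ> \<sigma> \<circ> inv x \<in> twisted_class n \<mu>"
proof -
  have xp: "x permutes {1..2*n}" and xc: "x \<circ> tau n = tau n \<circ> x"
    using assms(2) by (auto simp: centralizer_tau_def)
  have bx: "bij x" using xp by (rule permutes_bij)
  have xc': "x (tau n u) = tau n (x u)" for u using xc by (simp add: fun_eq_iff)
  have ic: "inv x (tau n u) = tau n (inv x u)" for u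
    by (metis bx bij_inv_eq_iff xc')
  obtain css where css: "mset (map length css) = \<mu>"
      "distinct (concat (css @ map (tau_sym n) css))"
      "set (concat (css @ map (tau_sym n) css)) = {1..2*n}"
      "\<sigma> = cycle_product (css @ map (tau_sym n) css)"
    and \<sigma>p: "\<sigma> permutes {1..2*n}" and \<sigma>t: "tau n \<circ> \<sigma> \<circ> tau n = inv \<sigma>"
    using assms(1) unfolding twisted_class_def by blast
  let ?L = "css @ map (tau_sym n) css"
  define ds where "ds = map (map x) css"
  have D: "ds @ map (tau_sym n) ds = map (map x) ?L"
    by (simp add: ds_def tau_sym_def rev_map comp_def xc')
  have 1: "mset (map length ds) = \<mu>" using css(1) by (simp add: ds_def comp_def)
  have 2: "distinct (concat (ds @ map (tau_sym n) ds))"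
    unfolding D using css(2) bx
    by (simp only: map_concat[symmetric] distinct_map) (metis bij_is_inj inj_on_subset subset_UNIV)
  have 3: "set (concat (ds @ map (tau_sym n) ds)) = {1..2*n}"
    unfolding D by (simp only: map_concat[symmetric] set_map css(3) permutes_image[OF xp])
  have 4: "x \<circ> \<sigma> \<circ> inv x = cycle_product (ds @ map (tau_sym n) ds)"
    unfolding D css(4) using cycle_product_conj[OF css(2) bx] .
  have 5: "x \<circ> \<sigma> \<circ> inv x permutes {1..2*n}"
    by (intro permutes_compose permutes_inv xp \<sigma>p)
  have "inv (x \<circ> \<sigma> \<circ> inv x) = x \<circ> inv \<sigma> \<circ> inv x"
    by (rule inv_unique_comp)
      (use bx permutes_bij[OF \<sigma>p] in
        \<open>simp_all add: fun_eq_iff bij_is_inj bij_is_surj surj_f_inv_f\<close>)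
  also have "\<dots> = tau n \<circ> (x \<circ> \<sigma> \<circ> inv x) \<circ> tau n"
    unfolding \<sigma>t[symmetric] by (simp add: fun_eq_iff xc' ic)
  finally show ?thesis unfolding twisted_class_def using 1 2 3 4 5 by auto
qed

lemma twisted_class_subset: "\<mu> \<in> partitions n \<Longrightarrow> twisted_class n \<mu> \<subseteq> twisted n"
  by (auto simp: twisted_def)

lemma lookup_class_sum:
  "Poly_Mapping.lookup (class_sum n \<mu>) \<sigma> = (if \<sigma> \<in> twisted_class n \<mu> then 1 else 0)"
  using finite_twisted_class[of n \<mu>]
  by (simp add: class_sum_def lookup_sum lookup_single when_def)

lemma lookup_conjugate:
  assumes "bij x"
  shows "Poly_Mapping.lookup (conjugate x y) (x \<circ> \<sigma> \<circ> inv x) = Poly_Mapping.lookup y \<sigma>"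
proof -
  have "x \<circ> \<rho> \<circ> inv x = x \<circ> \<sigma> \<circ> inv x \<longleftrightarrow> \<rho> = \<sigma>" for \<rho>
  proof
    assume eq: "x \<circ> \<rho> \<circ> inv x = x \<circ> \<sigma> \<circ> inv x"
    show "\<rho> = \<sigma>"
    proof
      fix u
      have "(x \<circ> \<rho> \<circ> inv x) (x u) = (x \<circ> \<sigma> \<circ> inv x) (x u)" using eq by simp
      then show "\<rho> u = \<sigma> u" using assms by (simp add: bij_is_inj inj_eq)
    qed
  qed simp
  then show ?thesis
    by (simp add: conjugate_def lookup_linear_extend lookup_single when_def in_keys_iff if_distrib cong: if_cong)
qed

lemma centralizer_tau_bij: "x \<in> centralizer_tau n \<Longrightarrow> bij x"
  by (auto simp: centralizer_tau_def permutes_bij)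

lemma centralizer_tau_inv:
  assumes "x \<in> centralizer_tau n"
  shows "inv x \<in> centralizer_tau n"
proof -
  have xp: "x permutes {1..2*n}" and "x \<circ> tau n = tau n \<circ> x"
    using assms by (auto simp: centralizer_tau_def)
  then have "x (tau n u) = tau n (x u)" for u by (simp add: fun_eq_iff)
  then have "inv x (tau n u) = tau n (inv x u)" for u
    by (metis bij_inv_eq_iff permutes_bij xp)
  then show ?thesis using xp by (auto simp: centralizer_tau_def permutes_inv fun_eq_iff)
qed

lemma twisted_center_iff:
  "y \<in> twisted_center n \<longleftrightarrow> Poly_Mapping.keys y \<subseteq> twisted n \<and>
    (\<forall>x\<in>centralizer_tau n. \<forall>\<sigma>. Poly_Mapping.lookup y (x \<circ> \<sigma> \<circ> inv x) = Poly_Mapping.lookup y \<sigma>)"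
proof -
  have "conjugate x y = y \<longleftrightarrow> (\<forall>\<sigma>. Poly_Mapping.lookup y (x \<circ> \<sigma> \<circ> inv x) = Poly_Mapping.lookup y \<sigma>)"
    if "x \<in> centralizer_tau n" for x
  proof -
    have bx: "bij x" using that by (rule centralizer_tau_bij)
    have "\<exists>\<sigma>. \<rho> = x \<circ> \<sigma> \<circ> inv x" for \<rho>
      by (rule exI[of _ "inv x \<circ> \<rho> \<circ> x"])
        (use bx in \<open>simp add: fun_eq_iff bij_is_surj surj_f_inv_f\<close>)
    then have "conjugate x y = y \<longleftrightarrow> (\<forall>\<sigma>. Poly_Mapping.lookup (conjugate x y) (x \<circ> \<sigma> \<circ> inv x)
        = Poly_Mapping.lookup y (x \<circ> \<sigma> \<circ> inv x))"
      by (metis poly_mapping_eqI)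
    then show ?thesis using lookup_conjugate[OF bx] by metis
  qed
  then show ?thesis by (auto simp: twisted_center_def)
qed

lemma class_sum_in_center:
  assumes "\<mu> \<in> partitions n"
  shows "class_sum n \<mu> \<in> twisted_center n"
proof -
  have "x \<circ> \<sigma> \<circ> inv x \<in> twisted_class n \<mu> \<longleftrightarrow> \<sigma> \<in> twisted_class n \<mu>"
    if x: "x \<in> centralizer_tau n" for x \<sigma>
  proof
    assume "x \<circ> \<sigma> \<circ> inv x \<in> twisted_class n \<mu>"
    from conjugate_twisted_class[OF this centralizer_tau_inv[OF x]]
    have "inv x \<circ> (x \<circ> \<sigma> \<circ> inv x) \<circ> inv (inv x) \<in> twisted_class n \<mu>" .
    moreover have "inv x \<circ> (x \<circ> \<sigma> \<circ> inv x) \<circ> inv (inv x) = \<sigma>"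
      using centralizer_tau_bij[OF x] by (simp add: inv_inv_eq fun_eq_iff bij_is_inj)
    ultimately show "\<sigma> \<in> twisted_class n \<mu>" by simp
  qed (rule conjugate_twisted_class[OF _ x])
  moreover have "Poly_Mapping.keys (class_sum n \<mu>) \<subseteq> twisted n"
    using twisted_class_subset[OF assms] by (auto simp: in_keys_iff lookup_class_sum split: if_splits)
  ultimately show ?thesis by (simp add: twisted_center_iff lookup_class_sum)
qed

lemma twisted_center_const:
  assumes "y \<in> twisted_center n" "\<sigma> \<in> twisted_class n \<mu>" "\<sigma>' \<in> twisted_class n \<mu>"
  shows "Poly_Mapping.lookup y \<sigma> = Poly_Mapping.lookup y \<sigma>'"
  using assms twisted_class_conj[OF assms(2,3)] by (auto simp: twisted_center_iff)

definition mon :: "nat multiset \<Rightarrow> (nat \<Rightarrow>\<^sub>0 nat)"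
  where "mon \<mu> = (\<Sum>k\<in>#\<mu>. Poly_Mapping.single k 1)"

lemma lookup_mon [simp]: "Poly_Mapping.lookup (mon \<mu>) k = count \<mu> k"
  by (induction \<mu>) (auto simp: mon_def lookup_add lookup_single)

lemma p_part_mon: "p_part \<mu> = Poly_Mapping.single (mon \<mu>) 1"
  by (induction \<mu>) (auto simp: p_part_def mon_def pvar_def mult_single)

lemma mon_eq_iff [simp]: "mon \<mu> = mon \<nu> \<longleftrightarrow> \<mu> = \<nu>"
  by (metis lookup_mon multiset_eqI)

lemma keys_mon: "Poly_Mapping.keys (mon \<mu>) = set_mset \<mu>"
  by (auto simp: in_keys_iff)

lemma weight_mon: "weight (mon \<mu>) = sum_mset \<mu>"
proof -
  have "(\<Sum>k\<in>A. k * count \<mu> k) = sum_mset \<mu>" if "finite A" "set_mset \<mu> \<subseteq> A" for A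
    using that
  proof (induction \<mu>)
    case (add x \<mu>)
    have "(\<Sum>k\<in>A. k * count (add_mset x \<mu>) k) = (\<Sum>k\<in>A. k * count \<mu> k + (if k = x then k else 0))"
      by (rule sum.cong) auto
    then show ?case using add by (simp add: sum.distrib)
  qed simp
  then show ?thesis by (simp add: weight_def keys_mon)
qed

lemma mon_surj: "\<exists>\<mu>. m = mon \<mu>"
proof -
  have "finite {k. 0 < Poly_Mapping.lookup m k}" using finite_lookup[of m] by simp
  then have "m = mon (Abs_multiset (Poly_Mapping.lookup m))"
    by (intro poly_mapping_eqI) simp
  then show ?thesis by blast
qed

lemma mon_in_hom: "\<mu> \<in> partitions n \<longleftrightarrow> Poly_Mapping.lookup (mon \<mu>) 0 = 0 \<and> weight (mon \<mu>) = n"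
  by (auto simp: partitions_def weight_mon not_in_iff)

lemma lookup_Psi:
  "Poly_Mapping.lookup (Psi n y) (mon \<mu>) =
    (if \<mu> \<in> partitions n then \<Sum>\<sigma>\<in>twisted_class n \<mu>. Poly_Mapping.lookup y \<sigma> else 0)"
  using finite_partitions[of n]
  by (simp add: Psi_def lookup_sum p_part_mon lookup_single when_def if_distrib cong: if_cong)

lemma Psi_class_sum:
  assumes "\<mu> \<in> partitions n"
  shows "Psi n (class_sum n \<mu>) = of_nat (card (twisted_class n \<mu>)) * p_part \<mu>"
proof (rule poly_mapping_eqI)
  fix m
  obtain \<nu> where m: "m = mon \<nu>" using mon_surj by blast
  have "(\<Sum>\<sigma>\<in>twisted_class n \<nu>. Poly_Mapping.lookup (class_sum n \<mu>) \<sigma>) =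
      (if \<nu> = \<mu> then of_nat (card (twisted_class n \<mu>)) else 0)" if "\<nu> \<in> partitions n"
  proof (cases "\<nu> = \<mu>")
    case False
    then have "Poly_Mapping.lookup (class_sum n \<mu>) \<sigma> = 0" if "\<sigma> \<in> twisted_class n \<nu>" for \<sigma>
      using that twisted_class_disjoint[of \<sigma> n \<nu> \<mu>] assms \<open>\<nu> \<in> partitions n\<close>
      by (auto simp: lookup_class_sum partitions_def)
    then show ?thesis using False by simp
  qed (simp add: lookup_class_sum)
  then show "Poly_Mapping.lookup (Psi n (class_sum n \<mu>)) m =
      Poly_Mapping.lookup (of_nat (card (twisted_class n \<mu>)) * p_part \<mu>) m"
    using assms by (auto simp: m lookup_Psi p_part_mon mult_single lookup_single when_def
        simp flip: single_of_nat)
qed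

lemma Psi_add: "Psi n (x + y) = Psi n x + Psi n y"
proof (rule poly_mapping_eqI)
  fix m
  obtain \<nu> where m: "m = mon \<nu>" using mon_surj by blast
  show "Poly_Mapping.lookup (Psi n (x + y)) m = Poly_Mapping.lookup (Psi n x + Psi n y) m"
    by (simp add: m lookup_Psi lookup_add sum.distrib)
qed

lemma Psi_scale: "Psi n (scale c y) = scale c (Psi n y)"
proof (rule poly_mapping_eqI)
  fix m
  obtain \<nu> where m: "m = mon \<nu>" using mon_surj by blast
  show "Poly_Mapping.lookup (Psi n (scale c y)) m = Poly_Mapping.lookup (scale c (Psi n y)) m"
    by (simp add: m lookup_Psi sum_distrib_left)
qed

lemma card_twisted_class: "\<mu> \<in> partitions n \<Longrightarrow> card (twisted_class n \<mu>) \<noteq> 0"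
  using twisted_class_nonempty finite_twisted_class by simp

lemma Psi_bij_betw: "bij_betw (Psi n) (twisted_center n) (hom_polys n)"
proof (intro bij_betwI')
  fix x y assume x: "x \<in> twisted_center n" and y: "y \<in> twisted_center n"
  show "Psi n x = Psi n y \<longleftrightarrow> x = y"
  proof
    assume eq: "Psi n x = Psi n y"
    show "x = y"
    proof (rule poly_mapping_eqI)
      fix \<sigma>
      show "Poly_Mapping.lookup x \<sigma> = Poly_Mapping.lookup y \<sigma>"
      proof (cases "\<sigma> \<in> twisted n")
        case True
        then obtain \<mu> where \<mu>: "\<mu> \<in> partitions n" "\<sigma> \<in> twisted_class n \<mu>" by (auto simp: twisted_def)
        have *: "Poly_Mapping.lookup (Psi n z) (mon \<mu>) =
            of_nat (card (twisted_class n \<mu>)) * Poly_Mapping.lookup z \<sigma>"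
          if "z \<in> twisted_center n" for z
        proof -
          have "(\<Sum>\<rho>\<in>twisted_class n \<mu>. Poly_Mapping.lookup z \<rho>) = (\<Sum>\<rho>\<in>twisted_class n \<mu>. Poly_Mapping.lookup z \<sigma>)"
            by (rule sum.cong[OF refl], rule twisted_center_const[OF that _ \<mu>(2)])
          then show ?thesis using \<mu> by (simp add: lookup_Psi)
        qed
        show ?thesis using *[OF x] *[OF y] eq card_twisted_class[OF \<mu>(1)] by simp
      next
        case False
        then have "\<sigma> \<notin> Poly_Mapping.keys x" "\<sigma> \<notin> Poly_Mapping.keys y"
          using x y by (auto simp: twisted_center_def)
        then show ?thesis by (simp add: in_keys_iff)
      qed
    qed
  qed simp
next
  fix y assume "y \<in> twisted_center n"
  show "Psi n y \<in> hom_polys n"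
    unfolding hom_polys_def
  proof (intro CollectI ballI)
    fix m assume m: "m \<in> Poly_Mapping.keys (Psi n y)"
    obtain \<nu> where \<nu>: "m = mon \<nu>" using mon_surj by blast
    then have "\<nu> \<in> partitions n" using m by (simp add: in_keys_iff lookup_Psi split: if_splits)
    then show "Poly_Mapping.lookup m 0 = 0 \<and> weight m = n"
      unfolding \<nu> mon_in_hom .
  qed
next
  fix f assume f: "f \<in> hom_polys n"
  define c where "c \<mu> = Poly_Mapping.lookup f (mon \<mu>) / of_nat (card (twisted_class n \<mu>))" for \<mu>
  define y where "y = (\<Sum>\<mu>\<in>partitions n. scale (c \<mu>) (class_sum n \<mu>))"
  have Psi0: "Psi n 0 = 0" by (simp add: Psi_def)
  have "Psi n y = (\<Sum>\<mu>\<in>partitions n. scale (c \<mu>) (Psi n (class_sum n \<mu>)))"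
    unfolding y_def using finite_partitions[of n]
    by (induction rule: finite_induct) (auto simp: Psi0 Psi_add Psi_scale)
  also have "\<dots> = (\<Sum>\<mu>\<in>partitions n. Poly_Mapping.single (mon \<mu>) (Poly_Mapping.lookup f (mon \<mu>)))"
  proof (rule sum.cong)
    fix \<mu> assume \<mu>: "\<mu> \<in> partitions n"
    have "of_nat (card (twisted_class n \<mu>)) * p_part \<mu> =
        Poly_Mapping.single (mon \<mu>) (of_nat (card (twisted_class n \<mu>)))"
      by (simp add: p_part_mon mult_single flip: single_of_nat)
    then show "scale (c \<mu>) (Psi n (class_sum n \<mu>)) =
        Poly_Mapping.single (mon \<mu>) (Poly_Mapping.lookup f (mon \<mu>))"
      using card_twisted_class[OF \<mu>]
      by (simp add: Psi_class_sum[OF \<mu>] scale_def c_def)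
  qed simp
  also have "\<dots> = f"
  proof (rule poly_mapping_eqI)
    fix m
    obtain \<nu> where m: "m = mon \<nu>" using mon_surj by blast
    have "Poly_Mapping.lookup f (mon \<nu>) = 0" if "\<nu> \<notin> partitions n"
      proof (rule ccontr)
      assume "Poly_Mapping.lookup f (mon \<nu>) \<noteq> 0"
      then have "mon \<nu> \<in> Poly_Mapping.keys f" by (simp add: in_keys_iff)
      then have "\<nu> \<in> partitions n" using f unfolding mon_in_hom hom_polys_def by blast
      with that show False by contradiction
    qed
    then show "Poly_Mapping.lookup (\<Sum>\<mu>\<in>partitions n. Poly_Mapping.single (mon \<mu>) (Poly_Mapping.lookup f (mon \<mu>))) m
        = Poly_Mapping.lookup f m"
      using finite_partitions[of n] by (auto simp: m lookup_sum lookup_single when_def)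
  qed
  finally have "Psi n y = f" .
  moreover have "y \<in> twisted_center n"
  proof -
    have "Poly_Mapping.keys y \<subseteq> twisted n"
    proof
      fix \<sigma> assume "\<sigma> \<in> Poly_Mapping.keys y"
      then have "(\<Sum>\<mu>\<in>partitions n. c \<mu> * Poly_Mapping.lookup (class_sum n \<mu>) \<sigma>) \<noteq> 0"
        by (simp add: in_keys_iff y_def lookup_sum)
      then have "\<exists>\<mu>\<in>partitions n. c \<mu> * Poly_Mapping.lookup (class_sum n \<mu>) \<sigma> \<noteq> 0"
        by (rule contrapos_np) (simp add: sum.neutral)
      then show "\<sigma> \<in> twisted n" by (auto simp: lookup_class_sum twisted_def split: if_splits)
    qed
    moreover have "Poly_Mapping.lookup y (x \<circ> \<sigma> \<circ> inv x) = Poly_Mapping.lookup y \<sigma>"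
      if "x \<in> centralizer_tau n" for x \<sigma>
      unfolding y_def lookup_sum lookup_scale
    proof (rule sum.cong)
      fix \<mu> assume "\<mu> \<in> partitions n"
      then have "class_sum n \<mu> \<in> twisted_center n" by (rule class_sum_in_center)
      then have "Poly_Mapping.lookup (class_sum n \<mu>) (x \<circ> \<sigma> \<circ> inv x) =
          Poly_Mapping.lookup (class_sum n \<mu>) \<sigma>"
        using that unfolding twisted_center_iff by blast
      then show "c \<mu> * Poly_Mapping.lookup (class_sum n \<mu>) (x \<circ> \<sigma> \<circ> inv x) =
          c \<mu> * Poly_Mapping.lookup (class_sum n \<mu>) \<sigma>" by (simp only:)
    qed simp
    ultimately show ?thesis unfolding twisted_center_iff by blast
  qed
  ultimately show "\<exists>y\<in>twisted_center n. f = Psi n y" by blast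
qed

lemma twisted_CJ_Psi:
  assumes "y \<in> twisted_center n"
  shows "twisted_CJ n (Psi n y) = Psi n (twisted_CJ_perm n y)"
  using Psi_bij_betw[of n] assms by (simp add: twisted_CJ_def bij_betw_def inv_into_f_f)

lemma pderiv_var_outside:
  assumes "\<And>m. m \<in> Poly_Mapping.keys f \<Longrightarrow> Poly_Mapping.lookup m k = 0"
  shows "pderiv_var k f = 0"
  unfolding pderiv_var_def linear_extend_def by (rule sum.neutral) (simp add: assms)

text \<open>
  Only finitely many partial derivatives of a polynomial are nonzero, so the sums over all
  indices by \<^const>\<open>Sum_any\<close> are genuine finite sums.
\<close>

lemma finite_pderiv_var: "finite {k. pderiv_var k f \<noteq> 0}"
proof (rule finite_subset)
  show "{k. pderiv_var k f \<noteq> 0} \<subseteq> (\<Union>m\<in>Poly_Mapping.keys f. Poly_Mapping.keys m)"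
  proof
    fix k assume "k \<in> {k. pderiv_var k f \<noteq> 0}"
    then obtain m where "m \<in> Poly_Mapping.keys f" "Poly_Mapping.lookup m k \<noteq> 0"
      using pderiv_var_outside[of f k] by blast
    then show "k \<in> (\<Union>m\<in>Poly_Mapping.keys f. Poly_Mapping.keys m)"
      by (auto simp: in_keys_iff)
  qed
qed simp

lemma finite_pderiv_var2: "finite {(i, j). pderiv_var i (pderiv_var j f) \<noteq> 0}"
proof (rule finite_subset)
  have "pderiv_var i 0 = 0" for i by (simp add: pderiv_var_def linear_extend_def)
  then show "{(i, j). pderiv_var i (pderiv_var j f) \<noteq> 0} \<subseteq>
      (\<lambda>(j, i). (i, j)) ` (SIGMA j:{j. pderiv_var j f \<noteq> 0}. {i. pderiv_var i (pderiv_var j f) \<noteq> 0})"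
    by (force simp: image_iff)
qed (simp add: finite_pderiv_var finite_SigmaI)

end

theory Submission
  imports Defs
begin

text \<open>
  For \<open>\<sigma>\<close> in \<open>B\<^sub>n\<^sup>~\<close> the product \<open>\<rho> = \<sigma>\<tau>\<close> is an involution without fixed points, and
  \<open>(i j) \<sigma> (\<tau>i \<tau>j) \<tau> = (i j) \<rho> (i j)\<close>. So \<open>\<sigma>\<close> is a graph on \<open>{1..2n}\<close>, the union of the two perfect
  matchings \<open>\<tau>\<close> and \<open>\<rho>\<close>; a pair of \<open>\<tau>\<close>-symmetric cycles of length \<open>k\<close> is a connected component with
  \<open>2k\<close> vertices, in which the two matchings alternate. A summand of the operator exchanges
  the \<open>\<rho>\<close>-partners of \<open>i\<close> and \<open>j\<close>, and there are three possibilities: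

  \<^item> \<open>i\<close> and \<open>j\<close> lie in components of sizes \<open>2k\<close> and \<open>2l\<close>: these join to one of size \<open>2(k + l)\<close>
    (\<open>half_cycles_merge\<close>);
  \<^item> \<open>i\<close> and \<open>j\<close> lie in the same cycle of \<open>\<sigma>\<close>, \<open>m\<close> steps apart: the component of size \<open>2k\<close> is cut into
    components of sizes \<open>2m\<close> and \<open>2(k - m)\<close> (\<open>half_cycles_split\<close>);
  \<^item> \<open>i\<close> and \<open>j\<close> lie in the two different cycles of one pair: a part of the component is reversed and
    its size does not change (\<open>half_cycles_flip\<close>).

  For a fixed \<open>i\<close> in a component of size \<open>2k\<close>, the number of \<open>j\<close> is \<open>2l\<close> for each other component of
  size \<open>2l\<close> in the first case, one for each \<open>m = 1, \<dots>, k - 1\<close> in the second, and \<open>k - 1\<close> in the third,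
  where \<open>j = \<tau>i\<close> is excluded (\<open>sum_swapped_at_head\<close>). The component of \<open>i\<close> has \<open>2k\<close> choices of \<open>i\<close>, and
  every unordered pair \<open>{i, j}\<close> is counted twice, so a part \<open>k\<close> of the type contributes \<open>k\<close> times
  the sum at a fixed \<open>i\<close> (\<open>sum_swapped\<close>).

  On the other side, \<open>k \<partial>/\<partial>p\<^sub>k\<close> applied to \<open>p\<^sub>\<mu>\<close> removes a part \<open>k\<close> in all possible ways with the
  same factor \<open>k\<close>, so the differential operator produces exactly this sum
  (\<open>cut_join_upto_p_part\<close>). Both sides are linear, and an element of the center is a combination of
  permutations \<open>\<sigma>\<close>; this gives the first formula. The second one differs only by
  \<open>k(k - 1) = \<Sum>\<^bsub>i+j=k\<^esub> (i + j)\<close>, as \<open>k\<close> has \<open>k - 1\<close> decompositions \<open>i + j\<close> with \<open>i, j \<ge> 1\<close>.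
\<close>

section \<open>Linear operators on formal combinations\<close>

lemma module_scale: "module scale"
  by unfold_locales (rule poly_mapping_eqI, simp add: lookup_add algebra_simps)+

lemma module_pair_scale: "module_pair scale scale"
  by (intro module_pair.intro module_scale)

abbreviation linear_op :: "(('a \<Rightarrow>\<^sub>0 complex) \<Rightarrow> ('b \<Rightarrow>\<^sub>0 complex)) \<Rightarrow> bool"
  where "linear_op \<equiv> module_hom scale scale"

lemma linear_opI:
  assumes "\<And>u v. T (u + v) = T u + T v" "\<And>c v. T (scale c v) = scale c (T v)"
  shows "linear_op T"
  by (simp add: module_hom_iff module_scale assms)

lemmas linear_op_add = module_pair.module_hom_add[OF module_pair_scale]

lemma linear_op_finite_sum:
  "finite I \<Longrightarrow> (\<And>i. i \<in> I \<Longrightarrow> linear_op (T i)) \<Longrightarrow> linear_op (\<lambda>v. \<Sum>i\<in>I. T i v)"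
  by (rule module_pair.module_hom_sum[OF module_pair_scale]) (auto intro: module_scale)

lemma linear_op_linear_extend: "linear_op (linear_extend f)"
proof -
  have superset: "linear_extend f v = (\<Sum>a\<in>S. scale (Poly_Mapping.lookup v a) (f a))"
    if "finite S" "Poly_Mapping.keys v \<subseteq> S" for v S
    unfolding linear_extend_def
    by (rule sum.mono_neutral_left) (use that in \<open>auto simp: in_keys_iff\<close>)
  interpret module scale by (rule module_scale)
  show ?thesis
  proof (rule linear_opI)
    fix u v :: "'a \<Rightarrow>\<^sub>0 complex"
    let ?S = "Poly_Mapping.keys u \<union> Poly_Mapping.keys v"
    show "linear_extend f (u + v) = linear_extend f u + linear_extend f v"
      by (simp add: superset[of ?S] keys_add lookup_add scale_left_distrib sum.distrib)
  next
    fix c and v :: "'a \<Rightarrow>\<^sub>0 complex"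
    have "Poly_Mapping.keys (scale c v) \<subseteq> Poly_Mapping.keys v" by (auto simp: in_keys_iff)
    then show "linear_extend f (scale c v) = scale c (linear_extend f v)"
      by (simp add: superset[of "Poly_Mapping.keys v"] scale_sum_right)
  qed
qed

lemma linear_op_eq_on_basis:
  assumes "linear_op S" "linear_op T"
    and "\<And>a. a \<in> Poly_Mapping.keys v \<Longrightarrow> S (Poly_Mapping.single a 1) = T (Poly_Mapping.single a 1)"
  shows "S v = T v"
proof -
  have v: "v = (\<Sum>a\<in>Poly_Mapping.keys v. scale (Poly_Mapping.lookup v a) (Poly_Mapping.single a 1))"
    by (rule poly_mapping_eqI) (simp add: lookup_sum lookup_single when_def in_keys_iff if_distrib cong: if_cong)
  have expand: "R v = (\<Sum>a\<in>Poly_Mapping.keys v. scale (Poly_Mapping.lookup v a) (R (Poly_Mapping.single a 1)))"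
    if "linear_op R" for R :: "('a \<Rightarrow>\<^sub>0 complex) \<Rightarrow> ('b \<Rightarrow>\<^sub>0 complex)"
    by (subst v) (simp add: module_hom.sum[OF that] module_hom.scale[OF that])
  show ?thesis using assms by (simp add: expand)
qed

lemma linear_op_Psi: "linear_op (Psi n)"
  by (rule linear_opI) (rule Psi_add, rule Psi_scale)

lemma linear_op_twisted_CJ_perm: "linear_op (twisted_CJ_perm n)"
  unfolding twisted_CJ_perm_def by (rule linear_op_linear_extend)

lemma linear_op_pderiv_var: "linear_op (pderiv_var k)"
  unfolding pderiv_var_def by (rule linear_op_linear_extend)

lemma linear_op_mult_left:
  fixes p :: poly_p
  assumes "linear_op T"
  shows "linear_op (\<lambda>v. p * T v)"
proof -
  have "scale c q = Poly_Mapping.single 0 c * q" for c and q :: poly_p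
    by (simp add: scale_def mult_map_scale_conv_mult)
  then show ?thesis
    by (intro linear_opI) (simp_all add: module_hom.add[OF assms] module_hom.scale[OF assms] algebra_simps)
qed

section \<open>One cycle from each symmetric pair\<close>

definition tau_inverting :: "nat \<Rightarrow> (nat \<Rightarrow> nat) \<Rightarrow> bool"
  where "tau_inverting n \<sigma> \<longleftrightarrow> \<sigma> permutes {1..2*n} \<and> tau n \<circ> \<sigma> \<circ> tau n = inv \<sigma>"

text \<open>
  The condition on the right says that \<open>\<sigma>\<tau>\<close> is an involution; without \<open>inv\<close> it can be rewritten
  pointwise.
\<close>

lemma tau_inverting_iff:
  "tau_inverting n \<sigma> \<longleftrightarrow> \<sigma> permutes {1..2*n} \<and> (\<forall>x. \<sigma> (tau n (\<sigma> x)) = tau n x)"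
proof (cases "\<sigma> permutes {1..2*n}")
  case True
  have "tau n \<circ> \<sigma> \<circ> tau n = inv \<sigma> \<longleftrightarrow> (\<forall>x. tau n (\<sigma> (tau n (\<sigma> x))) = x)"
    using True by (auto simp: fun_eq_iff permutes_inverses) (metis permutes_inverses(1))
  also have "\<dots> \<longleftrightarrow> (\<forall>x. \<sigma> (tau n (\<sigma> x)) = tau n x)"
    by (metis tau_tau)
  finally show ?thesis using True by (simp add: tau_inverting_def)
qed (simp add: tau_inverting_def)

text \<open>
  The lists contain one cycle from each pair of \<open>\<tau>\<close>-symmetric cycles of \<open>\<sigma>\<close>. Disjointness and covering
  are one equation of multisets because such an equation visibly survives the three changes of
  representatives that are used below: reordering the list, rotating a cycle, and replacing a cycle
  by its \<open>\<tau>\<close>-symmetric partner. That \<open>\<sigma>\<close> shifts the partners as well follows from \<open>\<tau>\<sigma>\<tau> = \<sigma>\<^sup>-\<^sup>1\<close>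
  (\<open>rotate1_tau_sym\<close>).
\<close>

definition half_cycles :: "nat \<Rightarrow> (nat \<Rightarrow> nat) \<Rightarrow> nat list list \<Rightarrow> bool"
  where "half_cycles n \<sigma> css \<longleftrightarrow>
    mset (concat css) + image_mset (tau n) (mset (concat css)) = mset_set {1..2*n} \<and>
    (\<forall>c\<in>set css. map \<sigma> c = rotate1 c)"

lemma mset_eq_mset_set_iff:
  assumes "finite A"
  shows "mset xs = mset_set A \<longleftrightarrow> distinct xs \<and> set xs = A"
proof
  assume *: "mset xs = mset_set A"
  then have "set xs = A" using assms by (metis finite_set_mset_mset_set set_mset_mset)
  moreover have "distinct xs" using * assms by (metis card_distinct calculation size_mset size_mset_set)
  ultimately show "distinct xs \<and> set xs = A" by simp
qed (auto simp: mset_set_set)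

lemma half_cycles_distinct:
  assumes "half_cycles n \<sigma> css"
  shows "distinct (concat css @ map (tau n) (concat css))"
    and "set (concat css @ map (tau n) (concat css)) = {1..2*n}"
  using assms mset_eq_mset_set_iff[of "{1..2*n}" "concat css @ map (tau n) (concat css)"]
  unfolding half_cycles_def by auto

text \<open>
  On \<open>\<tau>(u)\<close> the permutation \<open>\<sigma> = \<tau>\<sigma>\<^sup>-\<^sup>1\<tau>\<close> acts as \<open>\<sigma>\<^sup>-\<^sup>1\<close> on \<open>u\<close>, which is why the partner of a cycle is
  written in reverse order.
\<close>

lemma rotate1_tau_sym:
  assumes "tau_inverting n \<sigma>" "map \<sigma> c = rotate1 c"
  shows "map \<sigma> (tau_sym n c) = rotate1 (tau_sym n c)"
proof -
  have "rev c = rotate1 (rev (map \<sigma> c))" unfolding assms(2) by (cases c) auto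
  then have "map \<sigma> (tau_sym n c) = rotate1 (rev (map (\<sigma> \<circ> tau n \<circ> \<sigma>) c))"
    unfolding tau_sym_def by (metis (no_types, lifting) map_map rev_map rotate1_map)
  also have "\<sigma> \<circ> tau n \<circ> \<sigma> = tau n"
    using assms(1) by (auto simp: tau_inverting_iff)
  finally show ?thesis by (simp add: tau_sym_def rev_map)
qed

lemma twisted_class_iff:
  "\<sigma> \<in> twisted_class n \<mu> \<longleftrightarrow>
    tau_inverting n \<sigma> \<and> (\<exists>css. half_cycles n \<sigma> css \<and> mset (map length css) = \<mu>)"
proof -
  have "(distinct (concat (css @ map (tau_sym n) css)) \<and>
         set (concat (css @ map (tau_sym n) css)) = {1..2*n} \<and>
         \<sigma> = cycle_product (css @ map (tau_sym n) css)) \<longleftrightarrow> half_cycles n \<sigma> css"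
    (is "?lhs \<longleftrightarrow> _") if inv: "tau_inverting n \<sigma>" for css
  proof -
    let ?L = "css @ map (tau_sym n) css"
    have "mset (concat ?L) = mset (concat css) + image_mset (tau n) (mset (concat css))"
      by (simp only: concat_append mset_append concat_map_tau_sym)
    then have cover: "distinct (concat ?L) \<and> set (concat ?L) = {1..2*n} \<longleftrightarrow>
        mset (concat css) + image_mset (tau n) (mset (concat css)) = mset_set {1..2*n}"
      using mset_eq_mset_set_iff[of "{1..2*n}" "concat ?L"] by simp
    have act: "\<sigma> = cycle_product ?L \<longleftrightarrow> (\<forall>c\<in>set css. map \<sigma> c = rotate1 c)"
      if d: "distinct (concat ?L)" and s: "set (concat ?L) = {1..2*n}"
    proof
      have cyc: "map (cycle_of_list c) c = rotate1 c" if "c \<in> set ?L" for c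
      proof -
        have "distinct c" using d that by (meson distinct_concat_iff)
        from cyclic_rotation[OF this, of 1] show ?thesis by simp
      qed
      {
        assume "\<sigma> = cycle_product ?L"
        then show "\<forall>c\<in>set css. map \<sigma> c = rotate1 c"
          using cycle_product_inside[OF d] cyc by (metis (no_types, lifting) UnCI map_cong set_append)
      }
      {
        assume rot: "\<forall>c\<in>set css. map \<sigma> c = rotate1 c"
        then have rot': "map \<sigma> c = rotate1 c" if "c \<in> set ?L" for c
          using that rotate1_tau_sym[OF inv] by auto
        show "\<sigma> = cycle_product ?L"
        proof
          fix x
          show "\<sigma> x = cycle_product ?L x"
          proof (cases "x \<in> set (concat ?L)")
            case True
            then obtain c where c: "c \<in> set ?L" "x \<in> set c" by auto
            have "map \<sigma> c = map (cycle_of_list c) c" using rot'[OF c(1)] cyc[OF c(1)] by simp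
            then have "\<sigma> x = cycle_of_list c x" using c(2) by (meson map_eq_conv)
            then show ?thesis using cycle_product_inside[OF d c] by simp
          next
            case False
            then have "x \<notin> {1..2*n}" using s by blast
            then have "\<sigma> x = x" using inv by (auto simp: tau_inverting_def permutes_def)
            then show ?thesis using False cycle_product_outside by metis
          qed
        qed
      }
    qed
    show ?thesis unfolding half_cycles_def using cover act by blast
  qed
  then show ?thesis unfolding twisted_class_def tau_inverting_def by blast
qed

lemma half_cycles_cong_mset:
  assumes "half_cycles n \<sigma> css" "mset css = mset css'"
  shows "half_cycles n \<sigma> css'"
proof -
  have "mset (concat css) = mset (concat css')"
    by (simp only: mset_concat sum_mset_sum_list[symmetric] mset_map assms(2))
  moreover have "set css = set css'" using assms(2) by (rule mset_eq_setD)
  ultimately show ?thesis using assms(1) by (simp add: half_cycles_def)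
qed

lemma half_cycles_replace:
  assumes "half_cycles n \<sigma> (c # css)" "map \<sigma> d = rotate1 d"
    and "mset d + image_mset (tau n) (mset d) = mset c + image_mset (tau n) (mset c)"
  shows "half_cycles n \<sigma> (d # css)"
proof -
  have eq: "mset (concat (d # css)) + image_mset (tau n) (mset (concat (d # css)))
      = mset (concat (c # css)) + image_mset (tau n) (mset (concat (c # css)))"
    using arg_cong[OF assms(3), of "\<lambda>M. M + (mset (concat css) + image_mset (tau n) (mset (concat css)))"]
    by (simp add: add_ac)
  show ?thesis using assms(1,2) unfolding half_cycles_def eq by simp
qed

text \<open>
  Any point \<open>x\<close> may be assumed to be the first entry of its cycle: if it lies in the partner of \<open>c\<close>,
  exchange the two, then rotate.
\<close>

lemma half_cycles_start_at:
  assumes inv: "tau_inverting n \<sigma>" and css: "half_cycles n \<sigma> (c # css)"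
    and x: "x \<in> set c \<or> tau n x \<in> set c"
  shows "\<exists>as. half_cycles n \<sigma> ((x # as) # css) \<and> length (x # as) = length c"
proof -
  obtain d where d: "half_cycles n \<sigma> (d # css)" "x \<in> set d" "length d = length c"
  proof (cases "x \<in> set c")
    case False
    have "map \<sigma> c = rotate1 c" using css by (simp add: half_cycles_def)
    then have "half_cycles n \<sigma> (tau_sym n c # css)"
      by (intro half_cycles_replace[OF css] rotate1_tau_sym[OF inv])
        (simp_all add: tau_sym_def image_mset.compositionality comp_def)
    moreover have "x \<in> set (tau_sym n c)"
      using False x by (auto simp: tau_sym_def image_iff) (metis tau_tau)
    ultimately show ?thesis using that[of "tau_sym n c"] by (simp add: tau_sym_def)
  qed (use that[of c] css in simp)
  obtain us vs where dx: "d = us @ x # vs" using d(2) by (meson split_list)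
  have "map \<sigma> d = rotate1 d" using d(1) by (simp add: half_cycles_def)
  then have "map \<sigma> (rotate (length us) d) = rotate1 (rotate (length us) d)"
    by (metis rotate1_rotate_swap rotate_map)
  then have "half_cycles n \<sigma> ((x # vs @ us) # css)"
    by (intro half_cycles_replace[OF d(1)]) (simp_all add: dx rotate_append add_ac)
  then show ?thesis using d(3) dx by (intro exI[of _ "vs @ us"]) simp
qed

section \<open>Cutting, joining and reversing\<close>

definition swapped :: "nat \<Rightarrow> (nat \<Rightarrow> nat) \<Rightarrow> nat \<Rightarrow> nat \<Rightarrow> (nat \<Rightarrow> nat)"
  where "swapped n \<sigma> i j = transpose i j \<circ> \<sigma> \<circ> transpose (tau n i) (tau n j)"

lemma tau_transpose: "tau n (transpose i j x) = transpose (tau n i) (tau n j) (tau n x)"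
  by (metis bij_is_inj bij_tau inj_eq transpose_def)

text \<open>
  \<open>\<sigma>\<tau>\<close> is conjugated by \<open>(i j)\<close>, and a conjugate of an involution is an involution.
\<close>

lemma tau_inverting_swapped:
  assumes "tau_inverting n \<sigma>" "i \<in> {1..2*n}" "j \<in> {1..2*n}"
  shows "tau_inverting n (swapped n \<sigma> i j)"
proof -
  have "tau n i \<in> {1..2*n}" "tau n j \<in> {1..2*n}" using assms(2,3) tau_image by blast+
  then have "swapped n \<sigma> i j permutes {1..2*n}"
    using assms unfolding swapped_def tau_inverting_def
    by (intro permutes_compose permutes_swap_id) auto
  moreover have "swapped n \<sigma> i j (tau n (swapped n \<sigma> i j x)) = tau n x" for x
    using assms(1) by (simp add: swapped_def tau_inverting_iff tau_transpose)
  ultimately show ?thesis by (simp add: tau_inverting_iff)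
qed

lemma swapped_commute: "swapped n \<sigma> i j = swapped n \<sigma> j i"
  by (simp add: swapped_def transpose_commute)

lemma map_swapped_untouched:
  assumes "map \<sigma> c = rotate1 c" "set c \<inter> {i, j, tau n i, tau n j} = {}"
  shows "map (swapped n \<sigma> i j) c = rotate1 c"
proof -
  have "swapped n \<sigma> i j x = \<sigma> x" if x: "x \<in> set c" for x
  proof -
    have "\<sigma> x \<in> set c" using assms(1) x by (metis imageI list.set_map set_rotate1)
    then have "x \<noteq> tau n i" "x \<noteq> tau n j" "\<sigma> x \<noteq> i" "\<sigma> x \<noteq> j" using assms(2) x by auto
    then show ?thesis by (simp add: swapped_def)
  qed
  then have "map (swapped n \<sigma> i j) c = map \<sigma> c" by simp
  then show ?thesis using assms(1) by simp
qed

lemma map_swapped_path: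
  assumes "map \<sigma> xs = ys" "tau n i \<notin> set xs" "tau n j \<notin> set xs"
  shows "map (swapped n \<sigma> i j) xs = map (transpose i j) ys"
proof -
  have "transpose (tau n i) (tau n j) x = x" if "x \<in> set xs" for x
    using that assms(2,3) by (auto simp: transpose_def)
  then show ?thesis using assms(1) by (auto simp: swapped_def)
qed

lemma map_transpose_avoid:
  "i \<notin> set ys \<Longrightarrow> j \<notin> set ys \<Longrightarrow> map (transpose i j) ys = ys"
  by (rule map_idI) (auto simp: transpose_def)

lemma eq_tau_iff: "x = tau n y \<longleftrightarrow> tau n x = y"
  by (metis tau_tau)

text \<open>
  In the next three lemmas \<open>i\<close> opens its cycle. In the first two, none of \<open>\<tau>i\<close>, \<open>\<tau>j\<close> lies on the cycles of
  \<open>i\<close> and \<open>j\<close>, so the new permutation acts there as \<open>(i j) \<sigma>\<close>: the element that was sent to \<open>i\<close> is now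
  sent to \<open>j\<close> and conversely. If \<open>i\<close> and \<open>j\<close> open two different cycles, these are concatenated;
  if \<open>j\<close> occurs in the cycle of \<open>i\<close>, that cycle is cut before \<open>j\<close>.
\<close>

lemma half_cycles_merge:
  assumes "half_cycles n \<sigma> ((i # as) # (j # bs) # css)"
  shows "half_cycles n (swapped n \<sigma> i j) ((i # as @ j # bs) # css)"
proof -
  note d = half_cycles_distinct(1)[OF assms]
  have rot: "map \<sigma> (i # as) = as @ [i]" "map \<sigma> (j # bs) = bs @ [j]"
    "\<forall>c\<in>set css. map \<sigma> c = rotate1 c"
    using assms by (auto simp: half_cycles_def)
  have "tau n i \<notin> set (i # as)" "tau n j \<notin> set (i # as)" "tau n i \<notin> set (j # bs)" "tau n j \<notin> set (j # bs)"
    using d by (auto simp: eq_tau_iff)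
  then have "map (swapped n \<sigma> i j) (i # as) = map (transpose i j) (as @ [i])"
    "map (swapped n \<sigma> i j) (j # bs) = map (transpose i j) (bs @ [j])"
    using map_swapped_path[OF rot(1)] map_swapped_path[OF rot(2)] by blast+
  moreover have "map (transpose i j) as = as" "map (transpose i j) bs = bs"
    using d by (intro map_transpose_avoid; auto)+
  ultimately have new: "map (swapped n \<sigma> i j) (i # as @ j # bs) = rotate1 (i # as @ j # bs)"
    by simp
  have "set c \<inter> {i, j, tau n i, tau n j} = {}" if "c \<in> set css" for c
    using d that by (auto simp: eq_tau_iff)
  then have "\<forall>c\<in>set css. map (swapped n \<sigma> i j) c = rotate1 c"
    using rot(3) map_swapped_untouched by blast
  then show ?thesis using assms new by (simp add: half_cycles_def add_ac)
qed

lemma half_cycles_split: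
  assumes "half_cycles n \<sigma> ((i # as @ j # bs) # css)"
  shows "half_cycles n (swapped n \<sigma> i j) ((i # as) # (j # bs) # css)"
proof -
  note d = half_cycles_distinct(1)[OF assms]
  have rot: "map \<sigma> (i # as @ j # bs) = as @ j # bs @ [i]"
    "\<forall>c\<in>set css. map \<sigma> c = rotate1 c"
    using assms by (auto simp: half_cycles_def)
  have "tau n i \<notin> set (i # as @ j # bs)" "tau n j \<notin> set (i # as @ j # bs)"
    using d by (auto simp: eq_tau_iff)
  then have "map (swapped n \<sigma> i j) (i # as @ j # bs) = map (transpose i j) (as @ j # bs @ [i])"
    using map_swapped_path[OF rot(1)] by blast
  also have "\<dots> = as @ i # bs @ [j]"
  proof -
    have "map (transpose i j) as = as" "map (transpose i j) bs = bs"
      using d by (intro map_transpose_avoid; auto)+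
    then show ?thesis by simp
  qed
  finally have "map (swapped n \<sigma> i j) (i # as) @ map (swapped n \<sigma> i j) (j # bs) = (as @ [i]) @ (bs @ [j])"
    by simp
  then have new: "map (swapped n \<sigma> i j) (i # as) = rotate1 (i # as)"
      "map (swapped n \<sigma> i j) (j # bs) = rotate1 (j # bs)"
    by (subst (asm) append_eq_append_conv; simp)+
  have "set c \<inter> {i, j, tau n i, tau n j} = {}" if "c \<in> set css" for c
    using d that by (auto simp: eq_tau_iff)
  then have "\<forall>c\<in>set css. map (swapped n \<sigma> i j) c = rotate1 c"
    using rot(2) map_swapped_untouched by blast
  then show ?thesis using assms new by (simp add: half_cycles_def add_ac)
qed

text \<open>
  Here \<open>j = \<tau>u\<close> lies on the partner of the cycle of \<open>i\<close>. Starting at \<open>i\<close>, the new permutation follows the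
  old cycle as far as \<open>u = \<tau>j\<close>. There it continues like \<open>\<sigma>\<close> does from \<open>\<tau>i\<close>, that is, through the partner
  cycle, until \<open>\<sigma>\<close> would reach \<open>j\<close>, where it returns to \<open>i\<close>. So the segment after \<open>u\<close> is replaced by its
  partner.
\<close>

lemma half_cycles_flip:
  assumes inv: "tau_inverting n \<sigma>" and reps: "half_cycles n \<sigma> ((i # as @ u # bs) # css)"
  shows "half_cycles n (swapped n \<sigma> i (tau n u)) ((i # as @ u # tau_sym n bs) # css)"
proof -
  let ?\<sigma>' = "swapped n \<sigma> i (tau n u)" and ?B = "tau_sym n bs" and ?A = "tau_sym n as"
  note d = half_cycles_distinct(1)[OF reps]
  have rot: "map \<sigma> (i # as @ u # bs) = as @ u # bs @ [i]"
    "\<forall>c\<in>set css. map \<sigma> c = rotate1 c"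
    using reps by (auto simp: half_cycles_def)
  \<comment> \<open>With \<open>i\<close> in the last place, the partner opens with \<open>\<tau>i\<close> and the path from \<open>\<tau>i\<close> to \<open>\<tau>u\<close> is a prefix of it.\<close>
  have "map \<sigma> (as @ u # bs @ [i]) = rotate1 (as @ u # bs @ [i])"
    using arg_cong[OF rot(1), of rotate1] rot(1) by (simp add: rotate1_map[symmetric])
  then have "map \<sigma> (tau_sym n (as @ u # bs @ [i])) = rotate1 (tau_sym n (as @ u # bs @ [i]))"
    by (rule rotate1_tau_sym[OF inv])
  then have "map \<sigma> (tau n i # ?B) @ map \<sigma> (tau n u # ?A) = (?B @ [tau n u]) @ (?A @ [tau n i])"
    by (simp add: tau_sym_def)
  then have bwd: "map \<sigma> (tau n i # ?B) = ?B @ [tau n u]"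
    by (subst (asm) append_eq_append_conv) simp_all
  have "map \<sigma> (i # as) @ map \<sigma> (u # bs) = (as @ [u]) @ (bs @ [i])"
    using rot(1) by simp
  then have fwd: "map \<sigma> (i # as) = as @ [u]"
    by (subst (asm) append_eq_append_conv) simp_all
  have "map ?\<sigma>' (i # as) = map (transpose i (tau n u)) (as @ [u])"
    by (rule map_swapped_path[OF fwd]) (use d in \<open>auto simp: eq_tau_iff\<close>)
  also have "\<dots> = as @ [u]"
    by (rule map_transpose_avoid) (use d in \<open>auto simp: eq_tau_iff\<close>)
  finally have part1: "map ?\<sigma>' (i # as) = as @ [u]" .
  have "map (transpose (tau n i) u) (u # ?B) = tau n i # ?B"
  proof -
    have "map (transpose (tau n i) u) ?B = ?B"
      by (rule map_transpose_avoid) (use d in \<open>auto simp: tau_sym_def eq_tau_iff\<close>)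
    then show ?thesis by simp
  qed
  then have "map ?\<sigma>' (u # ?B) = map (transpose i (tau n u)) (map \<sigma> (tau n i # ?B))"
    by (simp only: swapped_def map_map[symmetric] tau_tau)
  also have "\<dots> = ?B @ [i]"
  proof -
    have "map (transpose i (tau n u)) ?B = ?B"
      by (rule map_transpose_avoid) (use d in \<open>auto simp: tau_sym_def eq_tau_iff\<close>)
    then show ?thesis unfolding bwd by simp
  qed
  finally have part2: "map ?\<sigma>' (u # ?B) = ?B @ [i]" .
  have new: "map ?\<sigma>' (i # as @ u # ?B) = rotate1 (i # as @ u # ?B)"
    using part1 part2 by simp
  have "set c \<inter> {i, tau n u, tau n i, tau n (tau n u)} = {}" if "c \<in> set css" for c
    using d that by (auto simp: eq_tau_iff)
  then have "\<forall>c\<in>set css. map ?\<sigma>' c = rotate1 c"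
    using rot(2) map_swapped_untouched by blast
  moreover have "image_mset (tau n) (mset ?B) = mset bs" "mset ?B = image_mset (tau n) (mset bs)"
    by (simp_all add: tau_sym_def image_mset.compositionality comp_def)
  ultimately show ?thesis using reps new by (simp add: half_cycles_def add_ac)
qed

section \<open>Counting the transpositions\<close>

lemma p_part_add_mset [simp]: "p_part (add_mset k \<mu>) = pvar k * p_part \<mu>"
  by (simp add: p_part_def)

text \<open>
  A permutation lies in the class of a single partition, so only one term of \<open>\<Psi>(\<sigma>)\<close> survives. Empty lists
  have to be ruled out, since the parts of a partition are positive.
\<close>

lemma Psi_basis:
  assumes inv: "tau_inverting n \<sigma>" and reps: "half_cycles n \<sigma> css" and ne: "[] \<notin> set css"
  shows "Psi n (Poly_Mapping.single \<sigma> 1) = p_part (mset (map length css))"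
proof -
  let ?\<mu> = "mset (map length css)"
  have "size (mset (concat css) + image_mset (tau n) (mset (concat css))) = 2 * n"
    using reps by (simp add: half_cycles_def)
  then have "sum_mset ?\<mu> = n" by (simp add: length_concat sum_mset_sum_list del: mset_map)
  then have part: "?\<mu> \<in> partitions n" using ne by (auto simp: partitions_def)
  have mem: "\<sigma> \<in> twisted_class n ?\<mu>" using inv reps twisted_class_iff by blast
  show "Psi n (Poly_Mapping.single \<sigma> 1) = p_part ?\<mu>"
  proof (rule poly_mapping_eqI)
    fix m
    obtain \<nu> where m: "m = mon \<nu>" using mon_surj by blast
    have "(\<Sum>\<rho>\<in>twisted_class n \<nu>. Poly_Mapping.lookup (Poly_Mapping.single \<sigma> 1) \<rho>) =
        (if \<sigma> \<in> twisted_class n \<nu> then 1 else 0 :: complex)"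
      using finite_twisted_class[of n \<nu>] by (simp add: lookup_single when_def)
    moreover have "\<sigma> \<in> twisted_class n \<nu> \<longleftrightarrow> ?\<mu> = \<nu>" if "\<nu> \<in> partitions n"
      using mem twisted_class_disjoint[OF mem, of \<nu>] part that by (auto simp: partitions_def)
    ultimately show "Poly_Mapping.lookup (Psi n (Poly_Mapping.single \<sigma> 1)) m =
        Poly_Mapping.lookup (p_part ?\<mu>) m"
      using part by (auto simp: m lookup_Psi p_part_mon lookup_single when_def simp del: mset_map)
  qed
qed

lemma sum_half_cycles:
  fixes g :: "nat \<Rightarrow> 'a::comm_monoid_add"
  assumes "half_cycles n \<sigma> css"
  shows "(\<Sum>x\<in>{1..2*n}. g x) = (\<Sum>c\<leftarrow>css. \<Sum>x\<leftarrow>c. g x + g (tau n x))"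
proof -
  have "(\<Sum>x\<in>{1..2*n}. g x) = (\<Sum>x\<in>#mset (concat css) + image_mset (tau n) (mset (concat css)). g x)"
    using assms by (simp only: sum_unfold_sum_mset half_cycles_def)
  also have "\<dots> = (\<Sum>x\<in>#mset (concat css). g x + g (tau n x))"
    by (simp add: sum_mset.distrib image_mset.compositionality comp_def)
  also have "\<dots> = (\<Sum>c\<leftarrow>css. \<Sum>x\<leftarrow>c. g x + g (tau n x))"
    by (induction css) (simp_all add: sum_mset_sum_list[symmetric])
  finally show ?thesis .
qed

text \<open>
  The sum of \<open>\<Psi>((i j) \<sigma> (\<tau>i \<tau>j))\<close> over all \<open>j\<close> for a fixed \<open>i\<close> in a cycle of length \<open>k\<close>, where \<open>\<nu>\<close> is the
  type of the other pairs (\<open>sum_swapped_at_head\<close>). The three terms come from cutting, reversing and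
  joining.
\<close>

definition cut_join_at :: "nat \<Rightarrow> nat multiset \<Rightarrow> poly_p"
  where "cut_join_at k \<nu> = (\<Sum>m\<in>{1..<k}. pvar m * pvar (k - m)) * p_part \<nu>
    + of_nat (k - 1) * pvar k * p_part \<nu>
    + (\<Sum>l\<in>#\<nu>. of_nat (2 * l) * pvar (k + l) * p_part (\<nu> - {#l#}))"

lemma sum_mset_lengths:
  "(\<Sum>k\<in>#mset (map length css). \<phi> k) = (\<Sum>c\<leftarrow>css. \<phi> (length c))"
  by (induction css) simp_all

text \<open>
  The points other than \<open>i\<close> and \<open>\<tau>i\<close> are: the other entries of the cycle of \<open>i\<close>, each cutting it at a
  different place; their images under \<open>\<tau>\<close>, each reversing a segment; and the \<open>2l\<close> points on every other
  pair of cycles of length \<open>l\<close>, all of them joining.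
\<close>

lemma sum_swapped_at_head:
  assumes inv: "tau_inverting n \<sigma>" and reps: "half_cycles n \<sigma> ((i # as) # css)"
    and ne: "[] \<notin> set css"
  shows "(\<Sum>j\<in>{1..2*n}. if j = i \<or> j = tau n i then 0
            else Psi n (Poly_Mapping.single (swapped n \<sigma> i j) 1))
         = cut_join_at (Suc (length as)) (mset (map length css))"
proof -
  let ?\<nu> = "mset (map length css)" and ?k = "Suc (length as)"
  define A where "A j = Psi n (Poly_Mapping.single (swapped n \<sigma> i j) 1)" for j
  note d = half_cycles_distinct(1)[OF reps]
  have mem: "i \<in> {1..2*n}" using half_cycles_distinct(2)[OF reps] by auto
  have inv': "tau_inverting n (swapped n \<sigma> i j)" if "j \<in> {1..2*n}" for j
    by (rule tau_inverting_swapped[OF inv mem that])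
  have range: "x \<in> {1..2*n}" "tau n x \<in> {1..2*n}" if "c \<in> set ((i # as) # css)" "x \<in> set c" for c x
    using half_cycles_distinct(2)[OF reps] that unfolding set_append set_map set_concat by blast+
  have cut: "A (as ! m) = pvar (Suc m) * pvar (?k - Suc m) * p_part ?\<nu>" if m: "m < length as" for m
  proof -
    have "as = take m as @ as ! m # drop (Suc m) as" using m by (simp add: id_take_nth_drop)
    then have "half_cycles n (swapped n \<sigma> i (as ! m)) ((i # take m as) # (as ! m # drop (Suc m) as) # css)"
      using half_cycles_split reps by metis
    then show ?thesis unfolding A_def
      using Psi_basis[OF inv'] range(1)[of "i # as" "as ! m"] ne m by (simp add: Suc_diff_Suc mult_ac)
  qed
  have flip: "A (tau n (as ! m)) = pvar ?k * p_part ?\<nu>" if m: "m < length as" for m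
  proof -
    have "as = take m as @ as ! m # drop (Suc m) as" using m by (simp add: id_take_nth_drop)
    then have "half_cycles n (swapped n \<sigma> i (tau n (as ! m)))
        ((i # take m as @ as ! m # tau_sym n (drop (Suc m) as)) # css)"
      using half_cycles_flip[OF inv] reps by metis
    moreover have "Suc (length as - Suc 0) = length as" using m by simp
    ultimately show ?thesis unfolding A_def
      using Psi_basis[OF inv'] range(2)[of "i # as" "as ! m"] ne m by (simp add: tau_sym_def)
  qed
  have join: "A x = pvar (?k + length c) * p_part (?\<nu> - {#length c#})"
    if c: "c \<in> set css" and x: "x \<in> set c \<or> tau n x \<in> set c" for c x
  proof -
    obtain us vs where css: "css = us @ c # vs" using c by (meson split_list)
    have "half_cycles n \<sigma> (c # (i # as) # us @ vs)"
      by (rule half_cycles_cong_mset[OF reps]) (simp add: css)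
    from half_cycles_start_at[OF inv this x] obtain bs
      where bs: "half_cycles n \<sigma> ((x # bs) # (i # as) # us @ vs)" "length (x # bs) = length c" by blast
    have "half_cycles n \<sigma> ((i # as) # (x # bs) # us @ vs)"
      by (rule half_cycles_cong_mset[OF bs(1)]) simp
    then have "half_cycles n (swapped n \<sigma> i x) ((i # as @ x # bs) # us @ vs)"
      by (rule half_cycles_merge)
    moreover have "x \<in> {1..2*n}" using range[of c] c x by (metis list.set_intros(2) tau_tau)
    ultimately have "A x = p_part (mset (map length ((i # as @ x # bs) # us @ vs)))"
      unfolding A_def using ne css by (intro Psi_basis inv') auto
    then show ?thesis by (simp add: css bs(2)[symmetric])
  qed
  define g where "g j = (if j = i \<or> j = tau n i then 0 else A j)" for j
  have g_A: "g x = A x" "g (tau n x) = A (tau n x)" if "x \<in> set as \<or> (\<exists>c\<in>set css. x \<in> set c)" for x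
    using d that by (auto simp: g_def eq_tau_iff)
  have "(\<Sum>x\<leftarrow>as. g x + g (tau n x)) = (\<Sum>x\<leftarrow>as. A x + A (tau n x))"
    using g_A by (intro arg_cong[of _ _ sum_list] map_cong) auto
  also have "\<dots> = (\<Sum>m<length as. A (as ! m) + A (tau n (as ! m)))"
    by (simp add: sum_list_sum_nth atLeast0LessThan)
  also have "\<dots> = (\<Sum>m<length as. pvar (Suc m) * pvar (?k - Suc m)) * p_part ?\<nu>
      + of_nat (length as) * pvar ?k * p_part ?\<nu>"
    by (simp add: cut flip sum.distrib sum_distrib_right mult.assoc del: mset_map)
  also have "(\<Sum>m<length as. pvar (Suc m) * pvar (?k - Suc m)) = (\<Sum>m\<in>{1..<?k}. pvar m * pvar (?k - m))"
    by (simp only: One_nat_def sum.atLeast_Suc_lessThan_Suc_shift comp_def atLeast0LessThan)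
  finally have own: "(\<Sum>x\<leftarrow>as. g x + g (tau n x)) =
      (\<Sum>m\<in>{1..<?k}. pvar m * pvar (?k - m)) * p_part ?\<nu> + of_nat (?k - 1) * pvar ?k * p_part ?\<nu>"
    by simp
  have "(\<Sum>x\<leftarrow>c. g x + g (tau n x)) =
      of_nat (2 * length c) * pvar (?k + length c) * p_part (?\<nu> - {#length c#})"
    if c: "c \<in> set css" for c
  proof -
    define q where "q = pvar (?k + length c) * p_part (?\<nu> - {#length c#})"
    have "g x + g (tau n x) = 2 * q" if x: "x \<in> set c" for x
    proof -
      have "g x = q" "g (tau n x) = q"
        unfolding q_def using g_A[of x] join[OF c, of x] join[OF c, of "tau n x"] c x tau_tau by metis+
      then show ?thesis by (simp only: mult_2)
    qed
    then have "map (\<lambda>x. g x + g (tau n x)) c = map (\<lambda>_. 2 * q) c"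
      unfolding map_eq_conv by blast
    then have "(\<Sum>x\<leftarrow>c. g x + g (tau n x)) = of_nat (length c) * (2 * q)"
      by (simp only: sum_list_triv)
    also have "\<dots> = of_nat (2 * length c) * q"
      by simp
    finally show ?thesis by (simp only: q_def mult.assoc)
  qed
  then have "map (\<lambda>c. \<Sum>x\<leftarrow>c. g x + g (tau n x)) css =
      map (\<lambda>c. of_nat (2 * length c) * pvar (?k + length c) * p_part (?\<nu> - {#length c#})) css"
    unfolding map_eq_conv by blast
  then have others: "(\<Sum>c\<leftarrow>css. \<Sum>x\<leftarrow>c. g x + g (tau n x)) =
      (\<Sum>l\<in>#?\<nu>. of_nat (2 * l) * pvar (?k + l) * p_part (?\<nu> - {#l#}))"
    by (simp only: sum_mset_lengths)
  have "(\<Sum>j\<in>{1..2*n}. g j) = (\<Sum>c\<leftarrow>(i # as) # css. \<Sum>x\<leftarrow>c. g x + g (tau n x))"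
    by (rule sum_half_cycles[OF reps])
  also have "\<dots> = (\<Sum>x\<leftarrow>as. g x + g (tau n x)) + (\<Sum>c\<leftarrow>css. \<Sum>x\<leftarrow>c. g x + g (tau n x))"
    by (simp add: g_def)
  also have "\<dots> = cut_join_at ?k ?\<nu>"
    by (simp only: own others cut_join_at_def)
  finally show ?thesis unfolding g_def A_def .
qed

text \<open>
  The summand is symmetric in \<open>i\<close> and \<open>j\<close>, and so is the condition \<open>j \<noteq> \<tau>i\<close>. So twice the sum over
  \<open>i < j\<close> is the sum over all \<open>i\<close> of the row sums above, and a pair of cycles of length \<open>k\<close> has \<open>2k\<close>
  equal rows.
\<close>

lemma sum_swapped:
  assumes inv: "tau_inverting n \<sigma>" and reps: "half_cycles n \<sigma> css" and ne: "[] \<notin> set css"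
  shows "(\<Sum>(i, j)\<in>{(i, j). 1 \<le> i \<and> i < j \<and> j \<le> 2 * n \<and> j \<noteq> tau n i}.
            Psi n (Poly_Mapping.single (swapped n \<sigma> i j) 1))
         = (\<Sum>k\<in>#mset (map length css). of_nat k * cut_join_at k (mset (map length css) - {#k#}))"
    (is "sum _ ?P = _")
proof -
  let ?\<mu> = "mset (map length css)" and ?N = "{1..2*n}"
  define A where "A i j = Psi n (Poly_Mapping.single (swapped n \<sigma> i j) 1)" for i j
  define row where "row i = (\<Sum>j\<in>?N. if j = i \<or> j = tau n i then 0 else A i j)" for i
  have row: "row x = cut_join_at (length c) (?\<mu> - {#length c#})"
    if c: "c \<in> set css" and x: "x \<in> set c \<or> tau n x \<in> set c" for c x
  proof -
    obtain us vs where css: "css = us @ c # vs" using c by (meson split_list)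
    have "half_cycles n \<sigma> (c # us @ vs)"
      by (rule half_cycles_cong_mset[OF reps]) (simp add: css)
    from half_cycles_start_at[OF inv this x] obtain bs
      where bs: "half_cycles n \<sigma> ((x # bs) # us @ vs)" "length (x # bs) = length c" by blast
    show ?thesis
      using sum_swapped_at_head[OF inv bs(1)] ne bs(2) unfolding row_def A_def by (simp add: css)
  qed
  have fin: "finite ?P"
    by (rule finite_subset[of _ "?N \<times> ?N"]) auto
  have sym: "(\<Sum>(i, j)\<in>prod.swap ` ?P. A i j) = (\<Sum>(i, j)\<in>?P. A i j)"
  proof -
    have "(\<lambda>(i, j). A i j) \<circ> prod.swap = (\<lambda>(i, j). A i j)"
    proof
      show "((\<lambda>(i, j). A i j) \<circ> prod.swap) ij = (case ij of (i, j) \<Rightarrow> A i j)" for ij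
        using swapped_commute[of n \<sigma> "fst ij" "snd ij"] by (cases ij) (simp add: A_def)
    qed
    then show ?thesis using sum.reindex[OF inj_on_subset[OF inj_swap subset_UNIV], of "\<lambda>(i, j). A i j" ?P]
      by simp
  qed
  have "2 * (\<Sum>(i, j)\<in>?P. A i j) = (\<Sum>(i, j)\<in>?P. A i j) + (\<Sum>(i, j)\<in>prod.swap ` ?P. A i j)"
    unfolding sym by (simp only: mult_2)
  also have "\<dots> = (\<Sum>(i, j)\<in>?P \<union> prod.swap ` ?P. A i j)"
    by (rule sum.union_disjoint[symmetric]) (use fin in auto)
  also have "\<dots> = (\<Sum>(i, j)\<in>?N \<times> ?N. if j = i \<or> j = tau n i then 0 else A i j)"
  proof (rule sum.mono_neutral_cong_left)
    have eq: "?P \<union> prod.swap ` ?P = {(i, j) \<in> ?N \<times> ?N. \<not> (j = i \<or> j = tau n i)}"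
      by (auto simp: eq_tau_iff image_iff)
    show "?P \<union> prod.swap ` ?P \<subseteq> ?N \<times> ?N" unfolding eq by auto
    show "\<forall>x\<in>?N \<times> ?N - (?P \<union> prod.swap ` ?P). (case x of (i, j) \<Rightarrow> if j = i \<or> j = tau n i then 0 else A i j) = 0"
      unfolding eq by auto
    show "(case x of (i, j) \<Rightarrow> A i j) = (case x of (i, j) \<Rightarrow> if j = i \<or> j = tau n i then 0 else A i j)"
      if "x \<in> ?P \<union> prod.swap ` ?P" for x
      using that unfolding eq by auto
  qed simp
  also have "\<dots> = (\<Sum>i\<in>?N. row i)"
    by (simp only: row_def sum.cartesian_product)
  also have "\<dots> = (\<Sum>c\<leftarrow>css. \<Sum>x\<leftarrow>c. row x + row (tau n x))"
    by (rule sum_half_cycles[OF reps])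
  also have "\<dots> = (\<Sum>c\<leftarrow>css. 2 * (of_nat (length c) * cut_join_at (length c) (?\<mu> - {#length c#})))"
  proof -
    have "(\<Sum>x\<leftarrow>c. row x + row (tau n x)) =
        2 * (of_nat (length c) * cut_join_at (length c) (?\<mu> - {#length c#}))" if c: "c \<in> set css" for c
    proof -
      define q where "q = cut_join_at (length c) (?\<mu> - {#length c#})"
      have "row x + row (tau n x) = 2 * q" if "x \<in> set c" for x
        using row[OF c, of x] row[OF c, of "tau n x"] that by (simp only: q_def tau_tau mult_2 simp_thms)
      then have "map (\<lambda>x. row x + row (tau n x)) c = map (\<lambda>_. 2 * q) c"
        unfolding map_eq_conv by blast
      then have "(\<Sum>x\<leftarrow>c. row x + row (tau n x)) = of_nat (length c) * (2 * q)"
        by (simp only: sum_list_triv)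
      then show ?thesis by (simp only: q_def mult.left_commute)
    qed
    then have "map (\<lambda>c. \<Sum>x\<leftarrow>c. row x + row (tau n x)) css =
        map (\<lambda>c. 2 * (of_nat (length c) * cut_join_at (length c) (?\<mu> - {#length c#}))) css"
      unfolding map_eq_conv by blast
    then show ?thesis by (simp only:)
  qed
  also have "\<dots> = 2 * (\<Sum>c\<leftarrow>css. of_nat (length c) * cut_join_at (length c) (?\<mu> - {#length c#}))"
    by (simp only: sum_list_const_mult)
  also have "(\<Sum>c\<leftarrow>css. of_nat (length c) * cut_join_at (length c) (?\<mu> - {#length c#}))
      = (\<Sum>k\<in>#?\<mu>. of_nat k * cut_join_at k (?\<mu> - {#k#}))"
    by (simp only: sum_mset_lengths)
  finally have double: "2 * (\<Sum>(i, j)\<in>?P. A i j) = 2 * (\<Sum>k\<in>#?\<mu>. of_nat k * cut_join_at k (?\<mu> - {#k#}))" .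
  have "p = q" if "2 * p = 2 * q" for p q :: poly_p
  proof (rule poly_mapping_eqI)
    fix m
    have "Poly_Mapping.lookup (p + p) m = Poly_Mapping.lookup (q + q) m"
      using that by (simp only: mult_2)
    then show "Poly_Mapping.lookup p m = Poly_Mapping.lookup q m"
      unfolding lookup_add by simp
  qed
  from this[OF double] show ?thesis by (simp add: A_def)
qed

section \<open>The differential operator on monomials\<close>

lemma pderiv_var_p_part:
  "pderiv_var k (p_part \<mu>) = of_nat (count \<mu> k) * p_part (\<mu> - {#k#})"
proof -
  have "mon \<mu> - Poly_Mapping.single k 1 = mon (\<mu> - {#k#})"
    by (rule poly_mapping_eqI) (auto simp: lookup_minus lookup_single when_def)
  moreover have "scale 1 q = q" for q :: poly_p by (rule poly_mapping_eqI) simp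
  ultimately show ?thesis
    by (simp add: pderiv_var_def linear_extend_def p_part_mon mult_single flip: single_of_nat)
qed

lemma pderiv_var_of_nat_mult: "pderiv_var k (of_nat a * p) = of_nat a * pderiv_var k p"
proof -
  have "of_nat a * q = scale (of_nat a) q" for q :: poly_p
    by (simp add: scale_def mult_map_scale_conv_mult)
  then show ?thesis by (simp add: module_hom.scale[OF linear_op_pderiv_var])
qed

lemma pderiv_var_hom_poly_eq_0:
  assumes f: "f \<in> hom_polys n" and k: "n < k"
  shows "pderiv_var k f = 0" "pderiv_var k (pderiv_var j f) = 0"
proof -
  have key: "Poly_Mapping.lookup m k = 0" if m: "m \<in> Poly_Mapping.keys f" for m
  proof (rule ccontr)
    assume *: "Poly_Mapping.lookup m k \<noteq> 0"
    then have "k * Poly_Mapping.lookup m k \<le> weight m"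
      unfolding weight_def by (intro member_le_sum) (auto simp: in_keys_iff)
    moreover have "k \<le> k * Poly_Mapping.lookup m k" using * by simp
    moreover have "weight m = n" using f m by (simp add: hom_polys_def)
    ultimately show False using k by linarith
  qed
  then show "pderiv_var k f = 0" by (rule pderiv_var_outside)
  show "pderiv_var k (pderiv_var j f) = 0"
  proof (rule pderiv_var_outside)
    fix m assume "m \<in> Poly_Mapping.keys (pderiv_var j f)"
    then obtain m' where "m' \<in> Poly_Mapping.keys f" "m = m' - Poly_Mapping.single j 1"
      unfolding in_keys_iff[of m] pderiv_var_def lookup_linear_extend
      by (metis (no_types, lifting) lookup_single_not_eq mult_zero_right sum.neutral)
    then show "Poly_Mapping.lookup m k = 0" using key by (simp add: lookup_minus)
  qed
qed

text \<open>
  The first form of the differential operator, cut off at the indices that can matter in degree \<open>n\<close>.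
  In contrast to the sums over all indices it is linear for formal reasons.
\<close>

definition cut_join_upto :: "nat \<Rightarrow> poly_p \<Rightarrow> poly_p"
  where "cut_join_upto n f =
    (\<Sum>i\<in>{1..n}. \<Sum>j\<in>{1..n}.
      of_nat (i + j) * pvar i * pvar j * pderiv_var (i + j) f
      + of_nat (2 * i * j) * pvar (i + j) * pderiv_var i (pderiv_var j f))
    + (\<Sum>k\<in>{1..n}. of_nat (k * (k - 1)) * pvar k * pderiv_var k f)"

lemma linear_op_cut_join_upto: "linear_op (cut_join_upto n)"
proof -
  have "linear_op (\<lambda>f. pderiv_var i (pderiv_var j f))" for i j
    using module_hom_compose[OF linear_op_pderiv_var linear_op_pderiv_var] by (simp add: comp_def)
  then show ?thesis
    unfolding cut_join_upto_def
    by (intro linear_op_add linear_op_finite_sum finite_atLeastAtMost linear_op_mult_left linear_op_pderiv_var)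
qed

lemma Sum_any_pairs_upto:
  fixes g :: "nat \<Rightarrow> nat \<Rightarrow> 'a::comm_monoid_add"
  assumes "\<And>i j. n < i \<or> n < j \<Longrightarrow> g i j = 0"
  shows "Sum_any (\<lambda>(i, j). (g i j when 1 \<le> i \<and> 1 \<le> j)) = (\<Sum>i\<in>{1..n}. \<Sum>j\<in>{1..n}. g i j)"
proof -
  have "Sum_any (\<lambda>(i, j). (g i j when 1 \<le> i \<and> 1 \<le> j)) =
      (\<Sum>(i, j)\<in>{1..n} \<times> {1..n}. (g i j when 1 \<le> i \<and> 1 \<le> j))"
  proof (rule Sum_any.expand_superset)
    show "{a. (case a of (i, j) \<Rightarrow> (g i j when 1 \<le> i \<and> 1 \<le> j)) \<noteq> 0} \<subseteq> {1..n} \<times> {1..n}"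
      using assms by (force simp: not_less[symmetric])
  qed simp
  also have "\<dots> = (\<Sum>(i, j)\<in>{1..n} \<times> {1..n}. g i j)"
    by (rule sum.cong) auto
  finally show ?thesis by (simp only: sum.cartesian_product)
qed

lemma sum_antidiagonals:
  fixes \<phi> :: "nat \<Rightarrow> nat \<Rightarrow> 'a::comm_monoid_add"
  assumes "\<And>i j. n < i + j \<Longrightarrow> \<phi> i j = 0"
  shows "(\<Sum>i\<in>{1..n}. \<Sum>j\<in>{1..n}. \<phi> i j) = (\<Sum>k\<in>{1..n}. \<Sum>m\<in>{1..<k}. \<phi> m (k - m))"
proof -
  have "(\<Sum>i\<in>{1..n}. \<Sum>j\<in>{1..n}. \<phi> i j) = (\<Sum>(i, j)\<in>{1..n} \<times> {1..n}. \<phi> i j)"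
    by (simp only: sum.cartesian_product)
  also have "\<dots> = (\<Sum>(i, j)\<in>{(i, j). 1 \<le> i \<and> 1 \<le> j \<and> i + j \<le> n}. \<phi> i j)"
  proof (rule sum.mono_neutral_right)
    show "\<forall>x\<in>{1..n} \<times> {1..n} - {(i, j). 1 \<le> i \<and> 1 \<le> j \<and> i + j \<le> n}.
        (case x of (i, j) \<Rightarrow> \<phi> i j) = 0"
      using assms by (force simp: not_le)
  qed auto
  also have "\<dots> = (\<Sum>(k, m)\<in>(SIGMA k:{1..n}. {1..<k}). \<phi> m (k - m))"
    by (rule sum.reindex_bij_witness[of _ "\<lambda>(k, m). (m, k - m)" "\<lambda>(i, j). (i + j, i)"]) auto
  finally show ?thesis by (simp add: sum.Sigma)
qed

lemma sum_mset_eq_sum_count: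
  fixes \<phi> :: "nat \<Rightarrow> 'a::comm_semiring_1"
  assumes "set_mset \<mu> \<subseteq> A" "finite A"
  shows "(\<Sum>k\<in>#\<mu>. \<phi> k) = (\<Sum>k\<in>A. of_nat (count \<mu> k) * \<phi> k)"
  using assms(1)
proof (induction \<mu>)
  case (add x \<mu>)
  have "(\<Sum>k\<in>A. of_nat (count (add_mset x \<mu>) k) * \<phi> k)
      = (\<Sum>k\<in>A. of_nat (count \<mu> k) * \<phi> k + (if k = x then \<phi> k else 0))"
    by (rule sum.cong) (auto simp: algebra_simps)
  then show ?case using add assms(2) by (simp add: sum.distrib add_ac)
qed simp

text \<open>
  \<open>\<partial>/\<partial>p\<^sub>k\<close> multiplies \<open>p\<^sub>\<mu>\<close> by the number of parts \<open>k\<close> and removes one of them, so a sum over indices with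
  derivatives is a sum over the parts of \<open>\<mu>\<close>.
\<close>

lemma cut_join_upto_p_part:
  assumes \<mu>: "\<mu> \<in> partitions n"
  shows "cut_join_upto n (p_part \<mu>) = (\<Sum>k\<in>#\<mu>. of_nat k * cut_join_at k (\<mu> - {#k#}))"
proof -
  let ?f = "p_part \<mu>"
  have "x \<le> n" if "x \<in># \<mu>" for x
    using that \<mu> by (metis (mono_tags, lifting) le_add1 mem_Collect_eq multi_member_split partitions_def sum_mset.add_mset)
  moreover have "1 \<le> x" if "x \<in># \<mu>" for x
    using that \<mu> by (cases x) (auto simp: partitions_def)
  ultimately have sub: "set_mset \<mu> \<subseteq> {1..n}" by auto
  have large: "count \<mu> k = 0" if "n < k" for k
    using sub that by (meson atLeastAtMost_iff count_eq_zero_iff linorder_not_le subsetD)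
  have cut: "(\<Sum>i\<in>{1..n}. \<Sum>j\<in>{1..n}. of_nat (i + j) * pvar i * pvar j * pderiv_var (i + j) ?f)
      = (\<Sum>k\<in>#\<mu>. of_nat k * ((\<Sum>m\<in>{1..<k}. pvar m * pvar (k - m)) * p_part (\<mu> - {#k#})))"
  proof -
    have "(\<Sum>i\<in>{1..n}. \<Sum>j\<in>{1..n}. of_nat (i + j) * pvar i * pvar j * pderiv_var (i + j) ?f)
        = (\<Sum>k\<in>{1..n}. \<Sum>m\<in>{1..<k}. of_nat (m + (k - m)) * pvar m * pvar (k - m) * pderiv_var (m + (k - m)) ?f)"
      by (rule sum_antidiagonals) (simp add: pderiv_var_p_part large)
    also have "\<dots> = (\<Sum>k\<in>{1..n}. of_nat (count \<mu> k) *
        (of_nat k * ((\<Sum>m\<in>{1..<k}. pvar m * pvar (k - m)) * p_part (\<mu> - {#k#}))))"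
      by (intro sum.cong refl) (simp add: pderiv_var_p_part sum_distrib_left sum_distrib_right mult_ac)
    finally show ?thesis unfolding sum_mset_eq_sum_count[OF sub finite_atLeastAtMost] .
  qed
  have flip: "(\<Sum>k\<in>{1..n}. of_nat (k * (k - 1)) * pvar k * pderiv_var k ?f)
      = (\<Sum>k\<in>#\<mu>. of_nat k * (of_nat (k - 1) * pvar k * p_part (\<mu> - {#k#})))"
    unfolding sum_mset_eq_sum_count[OF sub finite_atLeastAtMost]
    by (intro sum.cong refl) (simp add: pderiv_var_p_part mult_ac)
  have join: "(\<Sum>i\<in>{1..n}. \<Sum>j\<in>{1..n}. of_nat (2 * i * j) * pvar (i + j) * pderiv_var i (pderiv_var j ?f))
      = (\<Sum>k\<in>#\<mu>. of_nat k * (\<Sum>l\<in>#\<mu> - {#k#}. of_nat (2 * l) * pvar (k + l) * p_part (\<mu> - {#k#} - {#l#})))"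
  proof -
    have sub': "set_mset (\<mu> - {#k#}) \<subseteq> {1..n}" for k using sub by (meson in_diffD subset_iff)
    have "(\<Sum>k\<in>#\<mu>. of_nat k * (\<Sum>l\<in>#\<mu> - {#k#}. of_nat (2 * l) * pvar (k + l) * p_part (\<mu> - {#k#} - {#l#})))
       = (\<Sum>j\<in>{1..n}. \<Sum>i\<in>{1..n}. of_nat (2 * i * j) * pvar (i + j) * pderiv_var i (pderiv_var j ?f))"
      unfolding sum_mset_eq_sum_count[OF sub finite_atLeastAtMost] sum_mset_eq_sum_count[OF sub' finite_atLeastAtMost]
      by (intro sum.cong refl, simp only: sum_distrib_left, intro sum.cong refl)
        (simp add: pderiv_var_p_part pderiv_var_of_nat_mult mult_ac add.commute)
    also have "\<dots> = (\<Sum>i\<in>{1..n}. \<Sum>j\<in>{1..n}. of_nat (2 * i * j) * pvar (i + j) * pderiv_var i (pderiv_var j ?f))"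
      by (rule sum.swap)
    finally show ?thesis ..
  qed
  have "cut_join_upto n ?f =
      (\<Sum>i\<in>{1..n}. \<Sum>j\<in>{1..n}. of_nat (i + j) * pvar i * pvar j * pderiv_var (i + j) ?f)
    + (\<Sum>i\<in>{1..n}. \<Sum>j\<in>{1..n}. of_nat (2 * i * j) * pvar (i + j) * pderiv_var i (pderiv_var j ?f))
    + (\<Sum>k\<in>{1..n}. of_nat (k * (k - 1)) * pvar k * pderiv_var k ?f)"
    by (simp only: cut_join_upto_def sum.distrib)
  also have "\<dots> = (\<Sum>k\<in>#\<mu>. of_nat k * cut_join_at k (\<mu> - {#k#}))"
    unfolding cut join flip cut_join_at_def distrib_left sum_mset.distrib by (simp only: add_ac)
  finally show ?thesis .
qed

section \<open>The twisted cut-and-join operator\<close>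

lemma twisted_CJ_perm_basis:
  "twisted_CJ_perm n (Poly_Mapping.single \<sigma> 1) =
    (\<Sum>(i, j)\<in>{(i, j). 1 \<le> i \<and> i < j \<and> j \<le> 2 * n \<and> j \<noteq> tau n i}.
      Poly_Mapping.single (swapped n \<sigma> i j) 1)"
proof -
  have "scale 1 v = v" for v :: "(nat \<Rightarrow> nat) \<Rightarrow>\<^sub>0 complex" by (rule poly_mapping_eqI) simp
  then show ?thesis by (simp add: twisted_CJ_perm_def linear_extend_def swapped_def)
qed

text \<open>
  Both \<open>\<Psi> \<circ> CJ\<close> and (differential operator) \<open>\<circ> \<Psi>\<close> are linear on all of \<open>\<complex>[B\<^sub>n\<^sup>~]\<close>, and
  \<open>\<Psi>(\<sigma>) = p\<^sub>\<mu>\<close> for every single \<open>\<sigma>\<close> of type \<open>\<mu>\<close>. So it is enough to compare them at one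
  permutation.
\<close>

lemma twisted_CJ_eq_cut_join_upto:
  assumes f: "f \<in> hom_polys n"
  shows "twisted_CJ n f = cut_join_upto n f"
proof -
  obtain y where y: "y \<in> twisted_center n" "f = Psi n y"
    using f Psi_bij_betw[of n] by (metis bij_betw_imp_surj_on imageE)
  have "Psi n (twisted_CJ_perm n y) = cut_join_upto n (Psi n y)"
  proof (rule linear_op_eq_on_basis[where S = "\<lambda>y. Psi n (twisted_CJ_perm n y)"
        and T = "\<lambda>y. cut_join_upto n (Psi n y)"])
    show "linear_op (\<lambda>y. Psi n (twisted_CJ_perm n y))"
      using module_hom_compose[OF linear_op_twisted_CJ_perm linear_op_Psi] by (simp add: comp_def)
    show "linear_op (\<lambda>y. cut_join_upto n (Psi n y))"
      using module_hom_compose[OF linear_op_Psi linear_op_cut_join_upto] by (simp add: comp_def)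
    fix \<sigma> assume "\<sigma> \<in> Poly_Mapping.keys y"
    then obtain \<mu> where \<mu>: "\<mu> \<in> partitions n" "\<sigma> \<in> twisted_class n \<mu>"
      using y(1) by (auto simp: twisted_center_def twisted_def)
    then obtain css where inv: "tau_inverting n \<sigma>" and css: "half_cycles n \<sigma> css" "mset (map length css) = \<mu>"
      unfolding twisted_class_iff by blast
    have ne: "[] \<notin> set css" using \<mu>(1) css(2) by (force simp: partitions_def)
    have "Psi n (twisted_CJ_perm n (Poly_Mapping.single \<sigma> 1)) =
        (\<Sum>(i, j)\<in>{(i, j). 1 \<le> i \<and> i < j \<and> j \<le> 2 * n \<and> j \<noteq> tau n i}.
          Psi n (Poly_Mapping.single (swapped n \<sigma> i j) 1))"
      by (simp add: twisted_CJ_perm_basis module_hom.sum[OF linear_op_Psi] case_prod_unfold)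
    also have "\<dots> = cut_join_upto n (p_part \<mu>)"
      unfolding sum_swapped[OF inv css(1) ne] css(2) cut_join_upto_p_part[OF \<mu>(1)] ..
    also have "p_part \<mu> = Psi n (Poly_Mapping.single \<sigma> 1)"
      using Psi_basis[OF inv css(1) ne] unfolding css(2) ..
    finally show "Psi n (twisted_CJ_perm n (Poly_Mapping.single \<sigma> 1)) =
        cut_join_upto n (Psi n (Poly_Mapping.single \<sigma> 1))" .
  qed
  then show ?thesis using twisted_CJ_Psi[OF y(1)] y(2) by simp
qed

theorem theorem2p12:
  fixes n :: nat and f :: poly_p
  assumes "f \<in> hom_polys n"
  shows "twisted_CJ n f =
      Sum_any (\<lambda>(i, j).
        (of_nat (i + j) * pvar i * pvar j * pderiv_var (i + j) f
         + of_nat (2 * i * j) * pvar (i + j) * pderiv_var i (pderiv_var j f)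
         when 1 \<le> i \<and> 1 \<le> j))
      + Sum_any (\<lambda>k. (of_nat (k * (k - 1)) * pvar k * pderiv_var k f when 1 \<le> k))
    \<and> twisted_CJ n f =
      Sum_any (\<lambda>(i, j).
        (of_nat (i + j) * (pvar i * pvar j + pvar (i + j)) * pderiv_var (i + j) f
         + of_nat (2 * i * j) * pvar (i + j) * pderiv_var i (pderiv_var j f)
         when 1 \<le> i \<and> 1 \<le> j))"
proof -
  have large: "pderiv_var (i + j) f = 0" "pderiv_var i (pderiv_var j f) = 0" if "n < i \<or> n < j" for i j
  proof -
    show "pderiv_var (i + j) f = 0"
      by (rule pderiv_var_hom_poly_eq_0[OF assms]) (use that in auto)
    have "pderiv_var i 0 = 0" by (rule module_hom.zero[OF linear_op_pderiv_var])
    then show "pderiv_var i (pderiv_var j f) = 0"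
      using that pderiv_var_hom_poly_eq_0(2)[OF assms, of i j] pderiv_var_hom_poly_eq_0(1)[OF assms, of j] by auto
  qed
  have singles: "Sum_any (\<lambda>k. (of_nat (k * (k - 1)) * pvar k * pderiv_var k f when 1 \<le> k))
      = (\<Sum>k\<in>{1..n}. of_nat (k * (k - 1)) * pvar k * pderiv_var k f)"
  proof -
    have "Sum_any (\<lambda>k. (of_nat (k * (k - 1)) * pvar k * pderiv_var k f when 1 \<le> k))
        = (\<Sum>k\<in>{1..n}. (of_nat (k * (k - 1)) * pvar k * pderiv_var k f when 1 \<le> k))"
    proof (rule Sum_any.expand_superset)
      show "{k. (of_nat (k * (k - 1)) * pvar k * pderiv_var k f when 1 \<le> k) \<noteq> 0} \<subseteq> {1..n}"
        using pderiv_var_hom_poly_eq_0(1)[OF assms] by (force simp: not_less[symmetric])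
    qed simp
    then show ?thesis by simp
  qed
  have flip: "(\<Sum>i\<in>{1..n}. \<Sum>j\<in>{1..n}. of_nat (i + j) * pvar (i + j) * pderiv_var (i + j) f)
      = (\<Sum>k\<in>{1..n}. of_nat (k * (k - 1)) * pvar k * pderiv_var k f)"
  proof -
    have "(\<Sum>i\<in>{1..n}. \<Sum>j\<in>{1..n}. of_nat (i + j) * pvar (i + j) * pderiv_var (i + j) f)
      = (\<Sum>k\<in>{1..n}. \<Sum>m\<in>{1..<k}. of_nat (m + (k - m)) * pvar (m + (k - m)) * pderiv_var (m + (k - m)) f)"
      by (rule sum_antidiagonals) (simp add: pderiv_var_hom_poly_eq_0(1)[OF assms])
    also have "\<dots> = (\<Sum>k\<in>{1..n}. \<Sum>m\<in>{1..<k}. of_nat k * pvar k * pderiv_var k f)"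
      by (intro sum.cong refl) simp
    also have "\<dots> = (\<Sum>k\<in>{1..n}. of_nat (k * (k - 1)) * pvar k * pderiv_var k f)"
      by (intro sum.cong refl) (simp add: mult_ac)
    finally show ?thesis .
  qed
  show ?thesis
  proof
    show "twisted_CJ n f =
        Sum_any (\<lambda>(i, j).
          (of_nat (i + j) * pvar i * pvar j * pderiv_var (i + j) f
           + of_nat (2 * i * j) * pvar (i + j) * pderiv_var i (pderiv_var j f)
           when 1 \<le> i \<and> 1 \<le> j))
        + Sum_any (\<lambda>k. (of_nat (k * (k - 1)) * pvar k * pderiv_var k f when 1 \<le> k))"
      unfolding twisted_CJ_eq_cut_join_upto[OF assms] singles cut_join_upto_def
      by (subst Sum_any_pairs_upto[where n = n]) (simp_all add: large)
    show "twisted_CJ n f =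
        Sum_any (\<lambda>(i, j).
          (of_nat (i + j) * (pvar i * pvar j + pvar (i + j)) * pderiv_var (i + j) f
           + of_nat (2 * i * j) * pvar (i + j) * pderiv_var i (pderiv_var j f)
           when 1 \<le> i \<and> 1 \<le> j))"
      unfolding twisted_CJ_eq_cut_join_upto[OF assms] cut_join_upto_def flip[symmetric]
      by (subst Sum_any_pairs_upto[where n = n])
        (simp_all add: large sum.distrib distrib_left distrib_right mult.assoc)
  qed
qed

end
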